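(* Let $(\Omega,\mathscr F,\mathsf P)$ be a probability space equipped with a discrete-time filtration $(\mathscr F_t)_{t\in\mathbb N_0}$, $\mathscr F_t\subset\mathscr F$, let $d\in\mathbb N$, and let $S=(S_t)_{t\in\mathbb N_0}$ be a $d$-dimensional $\mathsf P$-local martingale. Then for every $\varepsilon>0$ there exists a uniformly integrable $\mathsf P$-martingale $Z=(Z_t)_{t\in\mathbb N_0}$ (one-dimensional), bounded from above by $1+\varepsilon$, with $Z_\infty=\lim_{t\uparrow\infty}Z_t>0$ and $\mathsf E_{\mathsf P}[Z_\infty]=1$, such that $ZS=(Z_tS_t)_{t\in\mathbb N_0}$ is a $\mathsf P$-martingale and such that $\mathsf E_{\mathsf P}[Z_t|S_t|^p]<\infty$ for all $t\in\mathbb N_0$ and all $p\in\mathbb N$.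
   Context: $\mathbb N=\{1,2,\dots\}$, $\mathbb N_0=\mathbb N\cup\{0\}$; $|\cdot|$ is the Euclidean norm. Relations between random variables are understood almost surely. For a stopping time $\tau$ (with values in $\mathbb N_0\cup\{\infty\}$) and a process $X$, $X^\tau$ denotes the process $X$ stopped at $\tau$, i.e. $X^\tau_t=X_{t\wedge\tau}$. A stochastic process $X=(X_t)_{t\in\mathbb N_0}$ is a $\mathsf P$-martingale if $\mathsf E_{\mathsf P}[|X_t|]<\infty$ and $\mathsf E_{\mathsf P}[X_{t+1}\mid\mathscr F_t]=X_t$ for all $t\in\mathbb N_0$. It is a $\mathsf P$-local martingale if there exists a sequence $(\tau_n)_{n\in\mathbb N}$ of stopping times such that $\lim_{n\uparrow\infty}\tau_n=\infty$ and $X^{\tau_n}\mathbf 1_{\{\tau_n>0\}}$ is a $\mathsf P$-martingale for each $n\in\mathbb N$. *)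

theory Defs
  imports "HOL-Probability.Probability"
begin

text \<open>The library's conditional expectation is real-valued; for vector-valued functions it is
  taken coordinatewise. For real-valued functions this is the library's notion, see below.\<close>

definition euclidean_cond_exp ::
  "'a measure \<Rightarrow> 'a measure \<Rightarrow> ('a \<Rightarrow> 'b::euclidean_space) \<Rightarrow> 'a \<Rightarrow> 'b" where
  "euclidean_cond_exp M G f = (\<lambda>\<omega>. \<Sum>b\<in>Basis. real_cond_exp M G (\<lambda>\<omega>. f \<omega> \<bullet> b) \<omega> *\<^sub>R b)"

lemma euclidean_cond_exp_real: "euclidean_cond_exp M G f = real_cond_exp M G f"
  for f :: "'a \<Rightarrow> real"
  by (simp add: euclidean_cond_exp_def)

text \<open>Adaptedness of \<open>X\<close> is not a separate clause: as all relations between random variables are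
  understood almost surely, the second clause only determines \<open>X t\<close> up to a null set, and it
  makes \<open>X t\<close> almost surely equal to an \<open>F t\<close>-measurable random variable.\<close>

definition martingale ::
  "'a measure \<Rightarrow> (nat \<Rightarrow> 'a measure) \<Rightarrow> (nat \<Rightarrow> 'a \<Rightarrow> 'b::euclidean_space) \<Rightarrow> bool" where
  "martingale M F X \<longleftrightarrow>
     (\<forall>t. integrable M (X t)) \<and>
     (\<forall>t. AE \<omega> in M. euclidean_cond_exp M (F t) (X (Suc t)) \<omega> = X t \<omega>)"

text \<open>The library's \<^const>\<open>stopping_time\<close> takes values in the time set itself; here the value
  \<open>\<infinity>\<close> is admitted, while time still ranges over the natural numbers.\<close>

definition ext_stopping_time :: "(nat \<Rightarrow> 'a measure) \<Rightarrow> ('a \<Rightarrow> enat) \<Rightarrow> bool" where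
  "ext_stopping_time F \<tau> \<longleftrightarrow> (\<forall>t. Measurable.pred (F t) (\<lambda>\<omega>. \<tau> \<omega> \<le> enat t))"

definition stopped_process :: "(nat \<Rightarrow> 'a \<Rightarrow> 'b) \<Rightarrow> ('a \<Rightarrow> enat) \<Rightarrow> nat \<Rightarrow> 'a \<Rightarrow> 'b" where
  "stopped_process X \<tau> t \<omega> = X (the_enat (min (enat t) (\<tau> \<omega>))) \<omega>"

definition local_martingale ::
  "'a measure \<Rightarrow> (nat \<Rightarrow> 'a measure) \<Rightarrow> (nat \<Rightarrow> 'a \<Rightarrow> 'b::euclidean_space) \<Rightarrow> bool" where
  "local_martingale M F X \<longleftrightarrow>
     (\<forall>t. X t \<in> borel_measurable M) \<and>
     (\<exists>\<tau> :: nat \<Rightarrow> 'a \<Rightarrow> enat.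
        (\<forall>n. ext_stopping_time F (\<tau> n)) \<and>
        (AE \<omega> in M. (\<lambda>n. \<tau> n \<omega>) \<longlonglongrightarrow> \<infinity>) \<and>
        (\<forall>n. martingale M F
               (\<lambda>t \<omega>. indicator {\<omega>. \<tau> n \<omega> > 0} \<omega> *\<^sub>R stopped_process X (\<tau> n) t \<omega>)))"

text \<open>The expectations are taken in the extended nonnegative reals so that the supremum is
  meaningful also when it is infinite.\<close>

definition uniformly_integrable ::
  "'a measure \<Rightarrow> (nat \<Rightarrow> 'a \<Rightarrow> 'b::euclidean_space) \<Rightarrow> bool" where
  "uniformly_integrable M X \<longleftrightarrow>
     (\<forall>t. integrable M (X t)) \<and>
     ((\<lambda>K::real. SUP t. \<integral>\<^sup>+ \<omega>. ennreal (norm (X t \<omega>)) * indicator {\<omega>. K < norm (X t \<omega>)} \<omega> \<partial>M)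
        \<longlongrightarrow> 0) at_top"

end

theory Submission
  imports Defs
begin

text \<open>
  \<^bold>\<open>Why the theorem holds.\<close> The process \<open>Z\<close> is the density process of an equivalent probability
  measure with density \<open>D\<close>, so it suffices to find \<open>D > 0\<close> with \<open>D \<le> 1 + \<epsilon>\<close> and mean \<open>1\<close> such that
  the increments of \<open>S\<close> keep conditional mean zero after weighting by \<open>D\<close> and \<open>D * |S t| ^ p\<close> is
  integrable for all \<open>t\<close> and \<open>p\<close>.

  \<^bold>\<open>One step\<close> (\<open>moment_preserving_damping\<close>). Let finitely many functions \<open>W\<close> be bounded by \<open>A\<close>, and
  let \<open>t N\<close> be \<open>1\<close> where \<open>A \<le> N\<close> and \<open>exp (- A)\<close> elsewhere. This factor bounds all powers of \<open>A\<close>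
  in terms of \<open>N\<close>, but it changes the conditional expectations of the \<open>W\<close>, by an error that tends to zero
  as \<open>N\<close> grows. The error is repaired by adding a combination \<open>u\<close> of the functions \<open>W * exp (- 2 * A)\<close>
  with coefficients that are measurable with respect to the past. After a conditional Gram-Schmidt
  process (\<open>conditional_gram_schmidt\<close>) with weight \<open>exp (- 2 * A)\<close> each coefficient is a quotient of an
  error by a conditional squared norm; where the norm vanishes so does the error, and therefore
  degenerate conditional laws need no selection argument. If \<open>N\<close>, which may depend on the past, is
  large, the coefficients are small, hence \<open>\<bar>u\<bar> \<le> \<delta> * exp (- A)\<close>, and \<open>t N + u\<close> is positive and at most
  \<open>1 + \<delta>\<close>.

  \<^bold>\<open>Finite horizon\<close> (\<open>finite_horizon_density\<close>). The powers of \<open>A\<close> are thereby controlled only by powers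
  of the random level \<open>N\<close>. But \<open>N\<close> is known one time step earlier, so a second factor, known at that
  time, can be chosen to control \<open>N\<close>, and so on backwards in time down to the trivial
  \<open>\<sigma>\<close>-algebra, where the level is a constant.

  \<^bold>\<open>Infinite horizon\<close> (\<open>equivalent_density\<close>). The finite horizon result is applied for horizon
  \<open>0, 1, 2, \<dots>\<close> in turn, each time under the measure already obtained. Because all factors are
  bounded by \<open>1 + e n\<close> with \<open>e\<close> summable, later stages cannot destroy integrability gained earlier;
  because the factors are \<open>e n\<close>-close to \<open>1\<close> in mean, their product converges to a positive limit
  \<open>D\<close>. The partial products \<open>E n\<close> approach \<open>D\<close> geometrically fast in mean and \<open>E (Suc t)\<close> is known at
  time \<open>t\<close>; this forces \<open>E[D|F t]\<close> to converge to \<open>D\<close> almost surely.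

  \<^bold>\<open>Localization\<close> (\<open>local_martingale_normalized_increment\<close>). For a local martingale the increments
  need not be integrable, but they become integrable with conditional mean zero after multiplication
  by a positive function known before the increment. Such a function affects neither the conditions
  on \<open>D\<close> nor their consequences for \<open>S\<close>.
\<close>

section \<open>Conditional expectations\<close>

lemma integrable_bounded_mult:
  fixes f g :: "'a \<Rightarrow> real"
  assumes "g \<in> borel_measurable M" "\<And>x. \<bar>g x\<bar> \<le> C" "integrable M f"
  shows "integrable M (\<lambda>x. g x * f x)"
proof (rule Bochner_Integration.integrable_bound)
  show "integrable M (\<lambda>x. C * f x)" using assms(3) by simp
  show "(\<lambda>x. g x * f x) \<in> borel_measurable M"
    using assms(1) borel_measurable_integrable[OF assms(3)] by measurable
  have "\<bar>g x * f x\<bar> \<le> \<bar>C * f x\<bar>" for x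
    using assms(2)[of x] by (auto simp: abs_mult intro!: mult_right_mono)
  then show "AE x in M. norm (g x * f x) \<le> norm (C * f x)" by simp
qed

context finite_measure_subalgebra
begin

lemma measurable_sub: "f \<in> borel_measurable F \<Longrightarrow> f \<in> borel_measurable M"
  using measurable_from_subalg[OF subalg] .

lemma real_cond_exp_bounded_mult:
  assumes "a \<in> borel_measurable F" "\<And>x. \<bar>a x\<bar> \<le> C" "integrable M f"
  shows "AE x in M. real_cond_exp M F (\<lambda>x. a x * f x) x = a x * real_cond_exp M F f x"
  using assms(1) borel_measurable_integrable[OF assms(3)]
    integrable_bounded_mult[OF measurable_sub[OF assms(1)] assms(2,3)]
  by (rule real_cond_exp_mult)

lemma real_cond_exp_lincomb:
  fixes f :: "'i \<Rightarrow> 'a \<Rightarrow> real"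
  assumes "finite I"
    and a0: "a0 \<in> borel_measurable F" "\<And>x. \<bar>a0 x\<bar> \<le> C" and f0: "integrable M f0"
    and a: "\<And>i. i \<in> I \<Longrightarrow> a i \<in> borel_measurable F" "\<And>i x. i \<in> I \<Longrightarrow> \<bar>a i x\<bar> \<le> C"
    and f: "\<And>i. i \<in> I \<Longrightarrow> integrable M (f i)"
  shows "AE x in M. real_cond_exp M F (\<lambda>x. a0 x * f0 x + (\<Sum>i\<in>I. a i x * f i x)) x
           = a0 x * real_cond_exp M F f0 x + (\<Sum>i\<in>I. a i x * real_cond_exp M F (f i) x)"
proof -
  have i0: "integrable M (\<lambda>x. a0 x * f0 x)"
    by (rule integrable_bounded_mult[where C=C]) (use a0 f0 measurable_sub in auto)
  have ii: "integrable M (\<lambda>x. a i x * f i x)" if "i \<in> I" for i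
    using integrable_bounded_mult[OF measurable_sub[OF a(1)[OF that]] a(2)[OF that] f[OF that]] .
  define h where "h = (\<lambda>i x. if i \<in> I then a i x * f i x else 0)"
  have ih: "integrable M (h i)" for i using ii[of i] by (cases "i \<in> I") (auto simp: h_def)
  have "AE x in M. real_cond_exp M F (\<lambda>x. \<Sum>i\<in>I. h i x) x = (\<Sum>i\<in>I. real_cond_exp M F (h i) x)"
    using real_cond_exp_sum[of h I] ih by simp
  moreover have "(\<lambda>x. \<Sum>i\<in>I. h i x) = (\<lambda>x. \<Sum>i\<in>I. a i x * f i x)" by (simp add: h_def)
  moreover have "AE x in M. \<forall>i\<in>I. real_cond_exp M F (h i) x = a i x * real_cond_exp M F (f i) x"
  proof (rule AE_finite_allI[OF assms(1)])
    fix i assume i: "i \<in> I"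
    then have "h i = (\<lambda>x. a i x * f i x)" by (auto simp: h_def)
    with i show "AE x in M. real_cond_exp M F (h i) x = a i x * real_cond_exp M F (f i) x"
      using real_cond_exp_bounded_mult[where a="a i" and C=C and f="f i"] a f by simp
  qed
  moreover have "AE x in M. real_cond_exp M F (\<lambda>x. a0 x * f0 x + (\<Sum>i\<in>I. a i x * f i x)) x
     = real_cond_exp M F (\<lambda>x. a0 x * f0 x) x + real_cond_exp M F (\<lambda>x. \<Sum>i\<in>I. a i x * f i x) x"
    using i0 ii by (intro real_cond_exp_add) auto
  moreover have "AE x in M. real_cond_exp M F (\<lambda>x. a0 x * f0 x) x = a0 x * real_cond_exp M F f0 x"
    by (rule real_cond_exp_bounded_mult[OF a0 f0])
  ultimately show ?thesis by (elim AE_mp) (auto intro!: AE_I2)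
qed

text \<open>The event that the conditional expectation vanishes is in \<open>F\<close>, so the integral of \<open>f\<close> over it is
  zero.\<close>

lemma AE_zero_where_real_cond_exp_zero:
  assumes "integrable M f" "AE x in M. 0 \<le> f x"
  shows "AE x in M. real_cond_exp M F f x = 0 \<longrightarrow> f x = 0"
proof -
  define a where "a = (\<lambda>x. if real_cond_exp M F f x = 0 then 1 else 0 :: real)"
  have a: "a \<in> borel_measurable F" "\<And>x. \<bar>a x\<bar> \<le> 1" by (auto simp: a_def)
  have i: "integrable M (\<lambda>x. a x * f x)"
    using integrable_bounded_mult[OF measurable_sub[OF a(1)] a(2) assms(1)] .
  have "(\<integral>x. a x * f x \<partial>M) = (\<integral>x. a x * real_cond_exp M F f x \<partial>M)"
    using real_cond_exp_intg(2)[of a f] i a(1) assms(1) by simp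
  also have "\<dots> = (\<integral>x. 0 \<partial>M)" by (rule Bochner_Integration.integral_cong) (auto simp: a_def)
  finally have "(\<integral>x. a x * f x \<partial>M) = 0" by simp
  moreover have "AE x in M. 0 \<le> a x * f x" using assms(2) by (auto simp: a_def)
  ultimately have "AE x in M. a x * f x = 0"
    using integral_nonneg_eq_0_iff_AE[OF i] by auto
  then show ?thesis by (auto simp: a_def)
qed

text \<open>The index takes only countably many values, and on each of its level sets, which belong to \<open>F\<close>, it
  may be frozen.\<close>

lemma real_cond_exp_random_index:
  fixes N :: "'a \<Rightarrow> nat"
  assumes N: "N \<in> measurable F (count_space UNIV)"
    and f: "\<And>n. integrable M (f n)" and fN: "integrable M (\<lambda>x. f (N x) x)"
  shows "AE x in M. real_cond_exp M F (\<lambda>x. f (N x) x) x = real_cond_exp M F (f (N x)) x"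
proof -
  define a where "a = (\<lambda>n x. if N x = n then 1 else 0 :: real)"
  have a: "a n \<in> borel_measurable F" "\<And>x. \<bar>a n x\<bar> \<le> 1" for n
    using N by (auto simp: a_def)
  have "AE x in M. a n x * real_cond_exp M F (\<lambda>x. f (N x) x) x = a n x * real_cond_exp M F (f n) x" for n
  proof -
    have "(\<lambda>x. a n x * f (N x) x) = (\<lambda>x. a n x * f n x)" by (auto simp: a_def)
    with real_cond_exp_bounded_mult[where a="a n" and C=1, OF a fN]
    have "AE x in M. real_cond_exp M F (\<lambda>x. a n x * f n x) x = a n x * real_cond_exp M F (\<lambda>x. f (N x) x) x"
      by simp
    with real_cond_exp_bounded_mult[where a="a n" and C=1, OF a f[of n]] show ?thesis
      by (elim AE_mp) (auto intro!: AE_I2)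
  qed
  then have "AE x in M. \<forall>n. a n x * real_cond_exp M F (\<lambda>x. f (N x) x) x = a n x * real_cond_exp M F (f n) x"
    by (simp add: AE_all_countable)
  then show ?thesis
  proof (rule AE_mp, intro AE_I2 impI)
    fix x assume "\<forall>n. a n x * real_cond_exp M F (\<lambda>x. f (N x) x) x = a n x * real_cond_exp M F (f n) x"
    from spec[OF this, of "N x"] show "real_cond_exp M F (\<lambda>x. f (N x) x) x = real_cond_exp M F (f (N x)) x"
      by (simp add: a_def)
  qed
qed

lemma abs_real_cond_exp_le:
  assumes i: "integrable M f"
  shows "AE x in M. \<bar>real_cond_exp M F f x\<bar> \<le> real_cond_exp M F (\<lambda>x. \<bar>f x\<bar>) x"
proof -
  have "AE x in M. real_cond_exp M F f x \<le> real_cond_exp M F (\<lambda>x. \<bar>f x\<bar>) x"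
    using i by (intro real_cond_exp_mono) auto
  moreover have "AE x in M. real_cond_exp M F (\<lambda>x. - 1 * f x) x \<le> real_cond_exp M F (\<lambda>x. \<bar>f x\<bar>) x"
    using i by (intro real_cond_exp_mono) auto
  moreover have "AE x in M. real_cond_exp M F (\<lambda>x. - 1 * f x) x = - 1 * real_cond_exp M F f x"
    using i by (intro real_cond_exp_cmult)
  ultimately show ?thesis by eventually_elim auto
qed

lemma integral_abs_real_cond_exp_le:
  assumes i: "integrable M f"
  shows "(\<integral>x. \<bar>real_cond_exp M F f x\<bar> \<partial>M) \<le> (\<integral>x. \<bar>f x\<bar> \<partial>M)"
proof -
  have "(\<integral>x. \<bar>real_cond_exp M F f x\<bar> \<partial>M) \<le> (\<integral>x. real_cond_exp M F (\<lambda>x. \<bar>f x\<bar>) x \<partial>M)"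
    using i abs_real_cond_exp_le[OF i] by (intro integral_mono_AE integrable_abs real_cond_exp_int) auto
  also have "\<dots> = (\<integral>x. \<bar>f x\<bar> \<partial>M)" using i by (intro real_cond_exp_int) auto
  finally show ?thesis .
qed

text \<open>The conditional expectations of \<open>\<bar>f n\<bar>\<close> converge almost surely by monotonicity. Their integrals
  tend to zero, so a subsequence, and therefore the whole sequence, tends to zero.\<close>

lemma real_cond_exp_dominated_zero:
  assumes f: "\<And>n. f n \<in> borel_measurable M" and g: "integrable M g" "\<And>n x. \<bar>f n x\<bar> \<le> g x"
    and dec: "\<And>n x. \<bar>f (Suc n) x\<bar> \<le> \<bar>f n x\<bar>" and lim: "\<And>x. (\<lambda>n. f n x) \<longlonglongrightarrow> 0"
  shows "AE x in M. (\<lambda>n. real_cond_exp M F (f n) x) \<longlonglongrightarrow> 0"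
proof -
  let ?E = "real_cond_exp M F"
  have i: "integrable M (f n)" for n
    by (rule Bochner_Integration.integrable_bound[OF g(1) f]) (use g(2) order_trans[OF g(2) abs_ge_self] in auto)
  define h where "h = (\<lambda>n x. ?E (\<lambda>x. \<bar>f n x\<bar>) x)"
  have ih: "integrable M (h n)" for n unfolding h_def using i by (intro real_cond_exp_int) auto
  have 1: "AE x in M. \<forall>n. 0 \<le> h n x"
    unfolding AE_all_countable h_def using f by (intro allI real_cond_exp_pos) auto
  have 2: "AE x in M. \<forall>n. h (Suc n) x \<le> h n x"
    unfolding AE_all_countable h_def using i dec by (intro allI real_cond_exp_mono) auto
  have 3: "AE x in M. \<forall>n. \<bar>?E (f n) x\<bar> \<le> h n x"
    unfolding AE_all_countable h_def using i by (intro allI abs_real_cond_exp_le)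
  have "(\<lambda>n. \<integral>x. \<bar>f n x\<bar> \<partial>M) \<longlonglongrightarrow> (\<integral>x. 0 \<partial>M)"
    by (rule integral_dominated_convergence[where w=g])
       (use f g lim in \<open>auto intro!: AE_I2 tendsto_rabs_zero\<close>)
  moreover have "(\<integral>x. norm (h n x) \<partial>M) = (\<integral>x. \<bar>f n x\<bar> \<partial>M)" for n
  proof -
    have "(\<integral>x. norm (h n x) \<partial>M) = (\<integral>x. h n x \<partial>M)"
      using 1 ih by (intro integral_cong_AE) auto
    also have "\<dots> = (\<integral>x. \<bar>f n x\<bar> \<partial>M)" unfolding h_def using i by (intro real_cond_exp_int) auto
    finally show ?thesis .
  qed
  ultimately have "(\<lambda>n. \<integral>x. norm (h n x) \<partial>M) \<longlonglongrightarrow> 0" by simp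
  from tendsto_L1_AE_subseq[OF ih this] obtain r where r: "strict_mono r"
    and "AE x in M. (\<lambda>n. h (r n) x) \<longlonglongrightarrow> 0" by auto
  with 1 2 3 show ?thesis
  proof (elim AE_mp, intro AE_I2 impI)
    fix x assume *: "\<forall>n. 0 \<le> h n x" "\<forall>n. h (Suc n) x \<le> h n x" "\<forall>n. \<bar>?E (f n) x\<bar> \<le> h n x"
      "(\<lambda>n. h (r n) x) \<longlonglongrightarrow> 0"
    have d: "decseq (\<lambda>n. h n x)" using *(2) by (auto intro: decseq_SucI)
    obtain L where L: "(\<lambda>n. h n x) \<longlonglongrightarrow> L"
      using decseq_convergent[OF d, of 0] *(1) by metis
    have "(\<lambda>n. h n x) \<longlonglongrightarrow> 0"
      using LIMSEQ_unique[OF LIMSEQ_subseq_LIMSEQ[OF L r, unfolded comp_def] *(4)] L by simp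
    then show "(\<lambda>n. ?E (f n) x) \<longlonglongrightarrow> 0"
      by (rule Lim_null_comparison[rotated]) (use *(3) in auto)
  qed
qed

section \<open>Adjusting one step\<close>

text \<open>Conditional Gram-Schmidt orthogonalization for the inner product \<open>E[w * f * g|F]\<close>. The
  coefficients are \<open>F\<close>-measurable but unbounded; dividing each new vector by \<open>1\<close> plus the sum of the
  absolute values of its coefficients keeps every vector below the common bound \<open>A\<close>, and thereby
  keeps all products integrable. In place of an explicit change of basis, the last clause records
  what is used of it: a function that is conditionally orthogonal to all new vectors is so to all old
  ones.\<close>

lemma conditional_gram_schmidt:
  fixes A w :: "'a \<Rightarrow> real"
  assumes H: "subalgebra H F"
    and w: "w \<in> borel_measurable M" "\<And>x. 0 < w x" "\<And>x. w x * (A x)\<^sup>2 \<le> 1"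
    and fin: "finite \<W>"
    and W: "\<And>W. W \<in> \<W> \<Longrightarrow> W \<in> borel_measurable H \<and> integrable M W \<and> (\<forall>x. \<bar>W x\<bar> \<le> A x)"
  shows "\<exists>\<V>. finite \<V> \<and>
    (\<forall>V\<in>\<V>. V \<in> borel_measurable H \<and> integrable M V \<and> (\<forall>x. \<bar>V x\<bar> \<le> A x)) \<and>
    (\<forall>V\<in>\<V>. \<forall>V'\<in>\<V>. V \<noteq> V' \<longrightarrow> (AE x in M. real_cond_exp M F (\<lambda>x. w x * (V x * V' x)) x = 0)) \<and>
    (\<forall>f C. f \<in> borel_measurable M \<longrightarrow> (\<forall>x. \<bar>f x\<bar> \<le> C) \<longrightarrow>
      (\<forall>V\<in>\<V>. AE x in M. real_cond_exp M F (\<lambda>x. f x * V x) x = 0) \<longrightarrow>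
      (\<forall>W\<in>\<W>. AE x in M. real_cond_exp M F (\<lambda>x. f x * W x) x = 0))"
  (is "\<exists>\<V>. ?fin \<V> \<and> ?dom \<V> \<and> ?orth \<V> \<and> ?ker \<V> \<W>")
  using fin W
proof (induction \<W>)
  case empty
  show ?case by (intro exI[of _ "{}"]) auto
next
  case (insert W \<W>)
  let ?E = "real_cond_exp M F"
  obtain \<V> where fin: "?fin \<V>" and dom: "?dom \<V>" and orth: "?orth \<V>" and ker: "?ker \<V> \<W>"
    using insert.IH insert.prems by auto
  have W: "W \<in> borel_measurable H" "integrable M W" "\<bar>W x\<bar> \<le> A x" for x using insert.prems by auto
  have V: "V \<in> borel_measurable H" "integrable M V" "\<bar>V x\<bar> \<le> A x" if "V \<in> \<V>" for V x
    using dom that by auto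
  have wn0: "w x \<noteq> 0" for x using w(2)[of x] by simp
  have w0: "0 \<le> w x" for x using w(2)[of x] by simp
  have A0: "0 \<le> A x" for x using W(3)[of x] by linarith
  have ww: "integrable M (\<lambda>x. w x * (f x * g x))"
    if "integrable M f" "integrable M g" "\<And>x. \<bar>f x\<bar> \<le> A x" "\<And>x. \<bar>g x\<bar> \<le> A x" for f g
  proof (rule integrable_const_bound[where B=1])
    have "\<bar>w x * (f x * g x)\<bar> \<le> 1" for x
    proof -
      have "\<bar>f x\<bar> * \<bar>g x\<bar> \<le> A x * A x" using that A0 by (intro mult_mono) auto
      then have "w x * (\<bar>f x\<bar> * \<bar>g x\<bar>) \<le> w x * (A x)\<^sup>2"
        using w0 by (intro mult_left_mono) (auto simp: power2_eq_square)
      then show ?thesis using w0[of x] order_trans[OF _ w(3)[of x]] by (simp add: abs_mult)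
    qed
    then show "AE x in M. norm (w x * (f x * g x)) \<le> 1" by simp
    show "(\<lambda>x. w x * (f x * g x)) \<in> borel_measurable M"
      using that w(1) by (auto intro!: borel_measurable_times)
  qed
  define c where "c = (\<lambda>V x. ?E (\<lambda>x. w x * (W x * V x)) x / ?E (\<lambda>x. w x * (V x * V x)) x)"
  have c[measurable]: "c V \<in> borel_measurable F" for V unfolding c_def by measurable
  define s where "s = (\<lambda>x. \<Sum>V\<in>\<V>. \<bar>c V x\<bar>)"
  have s[measurable]: "s \<in> borel_measurable F" unfolding s_def by measurable
  have s0: "0 \<le> s x" for x unfolding s_def by (intro sum_nonneg) auto
  define \<kappa> where "\<kappa> = (\<lambda>x. 1 / (1 + s x))"
  have \<kappa>[measurable]: "\<kappa> \<in> borel_measurable F" unfolding \<kappa>_def by measurable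
  have \<kappa>1: "0 < \<kappa> x" "\<bar>\<kappa> x\<bar> \<le> 1" for x using s0[of x] by (auto simp: \<kappa>_def field_simps)
  have \<kappa>n0: "\<kappa> x \<noteq> 0" for x using \<kappa>1(1)[of x] by simp
  have \<kappa>c: "\<bar>- \<kappa> x * c V x\<bar> \<le> 1" if "V \<in> \<V>" for V x
  proof -
    have "\<bar>c V x\<bar> \<le> s x" unfolding s_def using that fin by (intro member_le_sum) auto
    then show ?thesis using s0[of x] by (simp add: \<kappa>_def abs_mult field_simps)
  qed
  define U where "U = (\<lambda>x. \<kappa> x * W x + (\<Sum>V\<in>\<V>. - \<kappa> x * c V x * V x))"
  have FH: "f \<in> borel_measurable H" if "f \<in> borel_measurable F" for f :: "'a \<Rightarrow> real"
    using measurable_from_subalg[OF H that] .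
  have U1: "U \<in> borel_measurable H"
    unfolding U_def using W(1) V(1) FH[OF c] FH[OF \<kappa>]
    by (auto intro!: borel_measurable_add borel_measurable_sum borel_measurable_times borel_measurable_uminus)
  have U2: "integrable M U"
    unfolding U_def
    by (intro Bochner_Integration.integrable_add Bochner_Integration.integrable_sum
        integrable_bounded_mult[where C=1] measurable_sub)
       (use W V \<kappa>1 \<kappa>c in auto)
  have U3: "\<bar>U x\<bar> \<le> A x" for x
  proof -
    have eq: "\<bar>U x\<bar> = \<kappa> x * \<bar>W x - (\<Sum>V\<in>\<V>. c V x * V x)\<bar>"
      using \<kappa>1(1)[of x] unfolding U_def
      by (simp add: sum_negf sum_distrib_left[symmetric] mult.assoc right_diff_distrib[symmetric] abs_mult)
    have "\<bar>W x - (\<Sum>V\<in>\<V>. c V x * V x)\<bar> \<le> \<bar>W x\<bar> + (\<Sum>V\<in>\<V>. \<bar>c V x * V x\<bar>)"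
      using sum_abs[of "\<lambda>V. c V x * V x" \<V>] by linarith
    also have "\<dots> \<le> A x + (\<Sum>V\<in>\<V>. \<bar>c V x\<bar> * A x)"
      using W V by (intro add_mono sum_mono) (auto simp: abs_mult intro!: mult_left_mono)
    also have "\<dots> = (1 + s x) * A x" by (simp add: s_def sum_distrib_right distrib_right)
    finally have "\<bar>U x\<bar> \<le> \<kappa> x * ((1 + s x) * A x)"
      unfolding eq using \<kappa>1(1)[of x] by (intro mult_left_mono) auto
    also have "\<dots> = A x" using s0[of x] by (simp add: \<kappa>_def)
    finally show ?thesis .
  qed
  \<comment> \<open>Where the norm of \<open>V'\<close> vanishes, the convention for division makes the coefficient \<open>0\<close>; this is
    the right value because \<open>V'\<close> itself vanishes there.\<close>
  have orthU: "AE x in M. ?E (\<lambda>x. w x * (U x * V' x)) x = 0" if V': "V' \<in> \<V>" for V'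
  proof -
    have eq: "(\<lambda>x. w x * (U x * V' x)) =
       (\<lambda>x. \<kappa> x * (w x * (W x * V' x)) + (\<Sum>V\<in>\<V>. (- \<kappa> x * c V x) * (w x * (V x * V' x))))"
      unfolding U_def by (auto simp: algebra_simps sum_distrib_left)
    have "AE x in M. ?E (\<lambda>x. w x * (U x * V' x)) x
       = \<kappa> x * ?E (\<lambda>x. w x * (W x * V' x)) x
         + (\<Sum>V\<in>\<V>. (- \<kappa> x * c V x) * ?E (\<lambda>x. w x * (V x * V' x)) x)"
      unfolding eq
      by (rule real_cond_exp_lincomb[where C=1, OF fin \<kappa> \<kappa>1(2)]) (use W V V' \<kappa>c in \<open>auto intro!: ww\<close>)
    moreover have "AE x in M. \<forall>V\<in>\<V>. V \<noteq> V' \<longrightarrow> ?E (\<lambda>x. w x * (V x * V' x)) x = 0"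
      using orth V' by (intro AE_finite_allI fin) auto
    moreover have "AE x in M. ?E (\<lambda>x. w x * (V' x * V' x)) x = 0 \<longrightarrow> ?E (\<lambda>x. w x * (W x * V' x)) x = 0"
    proof -
      let ?B = "\<lambda>x. if ?E (\<lambda>x. w x * (V' x * V' x)) x = 0 then 1 else 0 :: real"
      have "AE x in M. ?E (\<lambda>x. w x * (V' x * V' x)) x = 0 \<longrightarrow> w x * (V' x * V' x) = 0"
        by (rule AE_zero_where_real_cond_exp_zero) (use V V' w0 in \<open>auto intro!: ww\<close>)
      then have "AE x in M. ?B x * (w x * (W x * V' x)) = 0"
        by eventually_elim (use wn0 in auto)
      then have "AE x in M. ?E (\<lambda>x. ?B x * (w x * (W x * V' x))) x = ?E (\<lambda>x. 0) x"
        by (rule real_cond_exp_cong)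
           (use w(1) W V V' in \<open>auto intro!: borel_measurable_times measurable_sub\<close>)
      moreover have "AE x in M. ?E (\<lambda>x. 0) x = 0" by (rule real_cond_exp_F_meas) auto
      moreover have "AE x in M. ?E (\<lambda>x. ?B x * (w x * (W x * V' x))) x = ?B x * ?E (\<lambda>x. w x * (W x * V' x)) x"
        by (rule real_cond_exp_bounded_mult[where C=1]) (use W V V' in \<open>auto intro!: ww\<close>)
      ultimately show ?thesis by (elim AE_mp) (auto intro!: AE_I2 split: if_splits)
    qed
    ultimately show ?thesis
    proof (elim AE_mp, intro AE_I2 impI)
      fix x assume *: "?E (\<lambda>x. w x * (U x * V' x)) x
       = \<kappa> x * ?E (\<lambda>x. w x * (W x * V' x)) x
         + (\<Sum>V\<in>\<V>. (- \<kappa> x * c V x) * ?E (\<lambda>x. w x * (V x * V' x)) x)"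
        "\<forall>V\<in>\<V>. V \<noteq> V' \<longrightarrow> ?E (\<lambda>x. w x * (V x * V' x)) x = 0"
        "?E (\<lambda>x. w x * (V' x * V' x)) x = 0 \<longrightarrow> ?E (\<lambda>x. w x * (W x * V' x)) x = 0"
      have "(\<Sum>V\<in>\<V>. (- \<kappa> x * c V x) * ?E (\<lambda>x. w x * (V x * V' x)) x)
        = (\<Sum>V\<in>\<V>. if V = V' then (- \<kappa> x * c V x) * ?E (\<lambda>x. w x * (V x * V' x)) x else 0)"
        using *(2) by (intro sum.cong) auto
      also have "\<dots> = (- \<kappa> x * c V' x) * ?E (\<lambda>x. w x * (V' x * V' x)) x"
        using fin V' by simp
      also have "\<dots> = - \<kappa> x * ?E (\<lambda>x. w x * (W x * V' x)) x"
        using *(3) by (auto simp: c_def)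
      finally show "?E (\<lambda>x. w x * (U x * V' x)) x = 0" using *(1) by simp
    qed
  qed
  have "?ker (insert U \<V>) (insert W \<W>)"
  proof (intro allI impI ballI)
    fix f C W' assume f: "f \<in> borel_measurable M" "\<forall>x. \<bar>f x\<bar> \<le> C"
      and 0: "\<forall>V\<in>insert U \<V>. AE x in M. ?E (\<lambda>x. f x * V x) x = 0" and W': "W' \<in> insert W \<W>"
    show "AE x in M. ?E (\<lambda>x. f x * W' x) x = 0"
    proof (cases "W' \<in> \<W>")
      case True
      with ker f 0 show ?thesis by blast
    next
      case False
      with W' have [simp]: "W' = W" by auto
      have fi: "integrable M (\<lambda>x. f x * g x)" if "integrable M g" for g
        by (rule integrable_bounded_mult[OF f(1) _ that]) (use f in auto)
      have eq: "(\<lambda>x. f x * U x) =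
         (\<lambda>x. \<kappa> x * (f x * W x) + (\<Sum>V\<in>\<V>. (- \<kappa> x * c V x) * (f x * V x)))"
        unfolding U_def by (auto simp: algebra_simps sum_distrib_left)
      have "AE x in M. ?E (\<lambda>x. f x * U x) x
         = \<kappa> x * ?E (\<lambda>x. f x * W x) x + (\<Sum>V\<in>\<V>. (- \<kappa> x * c V x) * ?E (\<lambda>x. f x * V x) x)"
        unfolding eq
        by (rule real_cond_exp_lincomb[where C=1, OF fin \<kappa> \<kappa>1(2)]) (use W V \<kappa>c in \<open>auto intro!: fi\<close>)
      moreover have "AE x in M. \<forall>V\<in>\<V>. ?E (\<lambda>x. f x * V x) x = 0"
        using 0 by (intro AE_finite_allI fin) auto
      moreover have "AE x in M. ?E (\<lambda>x. f x * U x) x = 0" using 0 by auto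
      ultimately show ?thesis
        by eventually_elim (use \<kappa>n0 in simp)
    qed
  qed
  moreover have "?fin (insert U \<V>)" using fin by simp
  moreover have "?dom (insert U \<V>)" using dom U1 U2 U3 by blast
  moreover have "?orth (insert U \<V>)"
  proof (intro ballI impI)
    fix V V' assume *: "V \<in> insert U \<V>" "V' \<in> insert U \<V>" "V \<noteq> V'"
    have "(\<lambda>x. w x * (V x * U x)) = (\<lambda>x. w x * (U x * V x))" by (auto simp: mult_ac)
    with * orth orthU show "AE x in M. ?E (\<lambda>x. w x * (V x * V' x)) x = 0" by auto
  qed
  ultimately show ?case by (intro exI[of _ "insert U \<V>"] conjI)
qed

end

lemma power_le_fact_exp:
  assumes "0 \<le> (a::real)" shows "exp (- a) * a ^ p \<le> fact p"
proof -
  have "(\<Sum>n\<in>{p}. a ^ n /\<^sub>R fact n) \<le> (\<Sum>n. a ^ n /\<^sub>R fact n)"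
    using assms by (intro sum_le_suminf summable_exp_generic) auto
  then have "a ^ p / fact p \<le> exp a" by (simp add: exp_def field_simps)
  then show ?thesis by (simp add: exp_minus field_simps)
qed

lemma (in prob_space) prob_tail_small:
  fixes A :: "'a \<Rightarrow> real"
  assumes "A \<in> borel_measurable M" "0 < \<delta>"
  shows "\<exists>n::nat. measure M {x\<in>space M. real n < A x} \<le> \<delta>"
proof -
  have "(\<lambda>n::nat. measure M {x\<in>space M. real n < A x}) \<longlonglongrightarrow> measure M (\<Inter>n::nat. {x\<in>space M. real n < A x})"
    using assms(1) by (intro finite_Lim_measure_decseq) (auto simp: decseq_def)
  moreover have "(\<Inter>n::nat. {x\<in>space M. real n < A x}) = {}"
  proof -
    have "\<exists>n::nat. \<not> real n < A x" for x using real_arch_simple[of "A x"] by (auto simp: not_less)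
    then show ?thesis by blast
  qed
  ultimately have "(\<lambda>n::nat. measure M {x\<in>space M. real n < A x}) \<longlonglongrightarrow> 0" by simp
  then have "eventually (\<lambda>n. measure M {x\<in>space M. real n < A x} < \<delta>) sequentially"
    using assms(2) by (rule order_tendstoD)
  then show ?thesis by (auto simp: eventually_sequentially intro: less_imp_le)
qed

context finite_measure_subalgebra
begin

text \<open>A factor \<open>1\<close> up to the level \<open>N\<close> and \<open>exp (- A)\<close> beyond it, plus a correction \<open>u\<close> that is at most
  \<open>\<delta> * exp (- A)\<close>, restores the conditional expectations of all \<open>W\<close> under \<open>M\<close>. The second measure \<open>R\<close>
  serves the later iteration, in which \<open>M\<close> is the measure reached at some stage, while convergence has
  to be shown under the original measure \<open>R\<close>. Closeness to \<open>1\<close> under \<open>R\<close> comes from the freedom to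
  prescribe a lower bound \<open>n0\<close> for the level: \<open>z\<close> differs from \<open>1\<close> by more than \<open>\<delta>\<close> only where \<open>A > n0\<close>.\<close>

lemma moment_preserving_damping:
  fixes A :: "'a \<Rightarrow> real" and R :: "'a measure"
  assumes H: "subalgebra M H" "subalgebra H F"
    and A: "A \<in> borel_measurable H" "\<And>x. 0 \<le> A x"
    and fin: "finite \<W>"
    and W: "\<And>W. W \<in> \<W> \<Longrightarrow> W \<in> borel_measurable H \<and> integrable M W \<and> (\<forall>x. \<bar>W x\<bar> \<le> A x)"
    and R: "prob_space R" "sets R = sets M"
    and \<epsilon>: "0 < \<epsilon>"
  obtains z :: "'a \<Rightarrow> real" and N :: "'a \<Rightarrow> nat"
  where "z \<in> borel_measurable H" "\<And>x. 0 < z x" "\<And>x. z x \<le> 1 + \<epsilon>"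
    and "(\<integral>x. \<bar>z x - 1\<bar> \<partial>R) \<le> \<epsilon>"
    and "N \<in> measurable F (count_space UNIV)"
    and "\<And>p x. z x * A x ^ p \<le> (1 + \<epsilon>) * (fact p + real (N x) ^ p)"
    and "\<And>W. W \<in> \<W> \<Longrightarrow> AE x in M. real_cond_exp M F (\<lambda>x. (z x - 1) * W x) x = 0"
proof -
  let ?E = "real_cond_exp M F"
  interpret R: prob_space R by (rule R)
  \<comment> \<open>\<open>3 * \<delta>\<close> pays for the deviation \<open>\<delta>\<close> on the bulk and a deviation of at most \<open>2\<close> on an event of
    probability \<open>\<delta>\<close>.\<close>
  define \<delta> where "\<delta> = min \<epsilon> 1 / 3"
  have \<delta>: "0 < \<delta>" "\<delta> < 1" "3 * \<delta> \<le> \<epsilon>" using \<epsilon> by (auto simp: \<delta>_def min_def)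
  have AM: "A \<in> borel_measurable M" using measurable_from_subalg[OF H(1) A(1)] .
  have AR: "A \<in> borel_measurable R" using AM measurable_cong_sets[OF R(2) refl] by blast
  define w where "w = (\<lambda>x. exp (- 2 * A x))"
  have wH: "w \<in> borel_measurable H" using A(1) unfolding w_def by measurable
  have wM: "w \<in> borel_measurable M" using measurable_from_subalg[OF H(1) wH] .
  have wA: "w x * A x \<le> exp (- A x)" for x
  proof -
    have "w x * A x = exp (- A x) * (exp (- A x) * A x ^ 1)"
      by (simp add: w_def mult_exp_exp flip: mult.assoc)
    also have "\<dots> \<le> exp (- A x) * fact 1"
      by (intro mult_left_mono power_le_fact_exp A) auto
    finally show ?thesis by simp
  qed
  have w0: "0 < w x" for x by (simp add: w_def)
  have wn0: "w x \<noteq> 0" for x by (simp add: w_def)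
  have wA2: "w x * (A x)\<^sup>2 \<le> 1" for x
  proof -
    have "w x * (A x)\<^sup>2 = (w x * A x) * A x" by (simp add: power2_eq_square)
    also have "\<dots> \<le> exp (- A x) * A x ^ 1" using wA A by (auto intro: mult_right_mono)
    also have "\<dots> \<le> fact 1" by (rule power_le_fact_exp[OF A(2)])
    finally show ?thesis by simp
  qed
  obtain \<V> where \<V>: "finite \<V>"
    and dom: "\<forall>V\<in>\<V>. V \<in> borel_measurable H \<and> integrable M V \<and> (\<forall>x. \<bar>V x\<bar> \<le> A x)"
    and orth: "\<forall>V\<in>\<V>. \<forall>V'\<in>\<V>. V \<noteq> V' \<longrightarrow> (AE x in M. ?E (\<lambda>x. w x * (V x * V' x)) x = 0)"
    and ker: "\<forall>f C. f \<in> borel_measurable M \<longrightarrow> (\<forall>x. \<bar>f x\<bar> \<le> C) \<longrightarrow>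
      (\<forall>V\<in>\<V>. AE x in M. ?E (\<lambda>x. f x * V x) x = 0) \<longrightarrow>
      (\<forall>W\<in>\<W>. AE x in M. ?E (\<lambda>x. f x * W x) x = 0)"
    using conditional_gram_schmidt[OF H(2) wM w0 wA2 fin W] by auto
  have V: "V \<in> borel_measurable H" "V \<in> borel_measurable M" "integrable M V" "\<bar>V x\<bar> \<le> A x"
    if "V \<in> \<V>" for V x
    using dom that measurable_from_subalg[OF H(1)] by auto
  have FH: "f \<in> borel_measurable H" if "f \<in> borel_measurable F" for f :: "'a \<Rightarrow> real"
    using measurable_from_subalg[OF H(2) that] .
  have iwVV: "integrable M (\<lambda>x. w x * (V x * V' x))" if VV: "V \<in> \<V>" "V' \<in> \<V>" for V V'
  proof (rule integrable_const_bound[where B=1])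
    have "\<bar>w x * (V x * V' x)\<bar> \<le> 1" for x
    proof -
      have "\<bar>V x\<bar> * \<bar>V' x\<bar> \<le> A x * A x" using V(4) VV A by (intro mult_mono) auto
      then have "w x * (\<bar>V x\<bar> * \<bar>V' x\<bar>) \<le> w x * (A x)\<^sup>2"
        using w0[of x] by (intro mult_left_mono) (auto simp: power2_eq_square)
      then show ?thesis using w0[of x] order_trans[OF _ wA2[of x]] by (simp add: abs_mult)
    qed
    then show "AE x in M. norm (w x * (V x * V' x)) \<le> 1" by simp
    show "(\<lambda>x. w x * (V x * V' x)) \<in> borel_measurable M"
      using V VV wM by (auto intro!: borel_measurable_times)
  qed
  define t where "t = (\<lambda>(n::nat) x. if A x \<le> real n then 1 else exp (- A x))"
  have tM: "t n \<in> borel_measurable M" for n using AM unfolding t_def by measurable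
  have t: "exp (- A x) \<le> t n x" "0 \<le> t n x" "t n x \<le> 1" for n x using A(2)[of x] by (auto simp: t_def)
  define q where "q = (\<lambda>V x. ?E (\<lambda>x. w x * (V x * V x)) x)"
  define e where "e = (\<lambda>V n x. ?E (\<lambda>x. (1 - t n x) * V x) x)"
  define \<theta> where "\<theta> = (\<lambda>V n x. e V n x / q V x)"
  have [measurable]: "q V \<in> borel_measurable F" "e V n \<in> borel_measurable F" "\<theta> V n \<in> borel_measurable F" for V n
    unfolding \<theta>_def q_def e_def by measurable
  define good where "good = (\<lambda>n x. (\<Sum>V\<in>\<V>. \<bar>\<theta> V n x\<bar>) \<le> \<delta>)"
  have [measurable]: "Measurable.pred F (good n)" for n unfolding good_def by measurable
  obtain n0 :: nat where n0: "measure R {x\<in>space R. real n0 < A x} \<le> \<delta>"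
    using R.prob_tail_small[OF AR \<delta>(1)] by auto
  \<comment> \<open>Outside a null set \<open>K\<close> is a level with small coefficients; on the null set \<open>\<mu>\<close> is set to \<open>0\<close>, so that
    the bounds on \<open>z\<close> hold everywhere.\<close>
  define K where "K = (\<lambda>x. LEAST n. n0 \<le> n \<and> good n x)"
  define N where "N = (\<lambda>x. max n0 (K x))"
  have K[measurable]: "K \<in> measurable F (count_space UNIV)" unfolding K_def by measurable
  have N[measurable]: "N \<in> measurable F (count_space UNIV)" unfolding N_def by measurable
  define \<mu> where "\<mu> = (\<lambda>V x. if good (N x) x then \<theta> V (N x) x else 0)"
  have [measurable]: "Measurable.pred F (\<lambda>x. good (N x) x)"
    by (rule measurable_compose_countable[OF _ N]) measurable
  have "(\<lambda>x. \<theta> V (N x) x) \<in> borel_measurable F" for V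
    by (rule measurable_compose_countable[OF _ N]) measurable
  then have \<mu>F[measurable]: "\<mu> V \<in> borel_measurable F" for V unfolding \<mu>_def by measurable
  have \<mu>s: "(\<Sum>V\<in>\<V>. \<bar>\<mu> V x\<bar>) \<le> \<delta>" for x
    using \<delta>(1) by (cases "good (N x) x") (simp_all add: \<mu>_def good_def)
  have \<mu>1: "\<bar>\<mu> V x\<bar> \<le> 1" if "V \<in> \<V>" for V x
  proof -
    have "\<bar>\<mu> V x\<bar> \<le> (\<Sum>V\<in>\<V>. \<bar>\<mu> V x\<bar>)" using \<V> that by (intro member_le_sum) auto
    then show ?thesis using \<mu>s[of x] \<delta> by linarith
  qed
  define u where "u = (\<lambda>x. \<Sum>V\<in>\<V>. \<mu> V x * (w x * V x))"
  have u: "\<bar>u x\<bar> \<le> \<delta> * exp (- A x)" for x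
  proof -
    have "\<bar>u x\<bar> \<le> (\<Sum>V\<in>\<V>. \<bar>\<mu> V x * (w x * V x)\<bar>)" unfolding u_def by (rule sum_abs)
    also have "\<dots> \<le> (\<Sum>V\<in>\<V>. \<bar>\<mu> V x\<bar> * exp (- A x))"
    proof (rule sum_mono)
      fix V assume "V \<in> \<V>"
      then have "w x * \<bar>V x\<bar> \<le> w x * A x" using V(4)[of V x] w0[of x] by (intro mult_left_mono) auto
      then have "w x * \<bar>V x\<bar> \<le> exp (- A x)" using wA[of x] by linarith
      then show "\<bar>\<mu> V x * (w x * V x)\<bar> \<le> \<bar>\<mu> V x\<bar> * exp (- A x)"
        using w0[of x] by (auto simp: abs_mult intro!: mult_left_mono)
    qed
    also have "\<dots> = (\<Sum>V\<in>\<V>. \<bar>\<mu> V x\<bar>) * exp (- A x)" by (simp add: sum_distrib_right)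
    also have "\<dots> \<le> \<delta> * exp (- A x)" using \<mu>s[of x] by (intro mult_right_mono) auto
    finally show ?thesis .
  qed
  define z where "z = (\<lambda>x. t (N x) x + u x)"
  have NH: "N \<in> measurable H (count_space UNIV)" using measurable_from_subalg[OF H(2) N] .
  have tN: "(\<lambda>x. t (N x) x) \<in> borel_measurable H"
    by (rule measurable_compose_countable[OF _ NH]) (use A(1) in \<open>simp add: t_def\<close>)
  have uH: "u \<in> borel_measurable H"
    unfolding u_def using V(1) FH[OF \<mu>F] wH by (auto intro!: borel_measurable_sum borel_measurable_times)
  have zH: "z \<in> borel_measurable H" unfolding z_def using tN uH by (rule borel_measurable_add)
  have zM: "z \<in> borel_measurable M" using measurable_from_subalg[OF H(1) zH] .
  have zR: "z \<in> borel_measurable R" using zM measurable_cong_sets[OF R(2) refl] by blast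
  have eA: "exp (- A x) \<le> 1" "\<delta> * exp (- A x) \<le> \<delta>" for x using A(2)[of x] \<delta> by (auto intro: mult_left_le)
  have tN': "exp (- A x) \<le> t (N x) x" "t (N x) x \<le> 1" for x by (rule t)+
  have z0: "0 < z x" for x
  proof -
    have "\<delta> * exp (- A x) < 1 * exp (- A x)" using \<delta> by (intro mult_strict_right_mono) auto
    then show ?thesis using u[of x] tN'(1)[of x] unfolding z_def by linarith
  qed
  have z1: "z x \<le> 1 + \<delta>" for x
    using u[of x] tN'(2)[of x] eA(2)[of x] unfolding z_def by linarith
  have z_near: "\<bar>z x - 1\<bar> \<le> \<delta> + 2 * indicator {x. real n0 < A x} x" for x
  proof (cases "A x \<le> real n0")
    case True
    then have "t (N x) x = 1" by (auto simp: t_def N_def max_def)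
    then show ?thesis using u[of x] eA(2)[of x] True unfolding z_def by simp
  next
    case False
    then show ?thesis using z0[of x] z1[of x] \<delta> by (simp add: abs_le_iff)
  qed
  have bd: "\<bar>z x - 1\<bar> \<le> 2" for x using z0[of x] z1[of x] \<delta> by (simp add: abs_le_iff)
  have zint: "(\<integral>x. \<bar>z x - 1\<bar> \<partial>R) \<le> \<epsilon>"
  proof -
    define S where "S = {x\<in>space R. real n0 < A x}"
    have S: "S \<in> sets R" using AR unfolding S_def by measurable
    have i1: "integrable R (\<lambda>x. \<bar>z x - 1\<bar>)"
      by (rule R.integrable_const_bound[where B=2]) (use bd zR in auto)
    have i2: "integrable R (\<lambda>x. \<delta> + 2 * indicator S x)"
      by (rule R.integrable_const_bound[where B="\<delta> + 2"]) (use S \<delta> in \<open>auto simp: indicator_def\<close>)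
    have "(\<integral>x. \<bar>z x - 1\<bar> \<partial>R) \<le> (\<integral>x. \<delta> + 2 * indicator S x \<partial>R)"
    proof (rule integral_mono[OF i1 i2])
      fix x assume "x \<in> space R"
      then show "\<bar>z x - 1\<bar> \<le> \<delta> + 2 * indicator S x"
        using z_near[of x] by (simp add: S_def indicator_def)
    qed
    also have "\<dots> = \<delta> + 2 * measure R S"
    proof -
      have "integrable R (\<lambda>x. 2 * indicator S x :: real)"
        by (rule R.integrable_const_bound[where B=2]) (use S in \<open>auto simp: indicator_def\<close>)
      then show ?thesis using S by (simp add: R.prob_space)
    qed
    finally show ?thesis using n0 \<delta> unfolding S_def by linarith
  qed
  have zp: "z x * A x ^ p \<le> (1 + \<epsilon>) * (fact p + real (N x) ^ p)" for x p
  proof (cases "A x \<le> real (N x)")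
    case True
    have "z x * A x ^ p \<le> (1 + \<epsilon>) * real (N x) ^ p"
      using z1[of x] \<delta> \<epsilon> True A(2)[of x] by (intro mult_mono power_mono) auto
    also have "\<dots> \<le> (1 + \<epsilon>) * (fact p + real (N x) ^ p)" using \<epsilon> by (intro mult_left_mono) auto
    finally show ?thesis .
  next
    case False
    then have "z x \<le> (1 + \<delta>) * exp (- A x)" using u[of x] by (simp add: z_def t_def algebra_simps)
    also have "\<dots> \<le> (1 + \<epsilon>) * exp (- A x)" using \<delta> \<epsilon> by (intro mult_right_mono) auto
    finally have "z x * A x ^ p \<le> (1 + \<epsilon>) * exp (- A x) * A x ^ p" using A(2)[of x] by (intro mult_right_mono) auto
    also have "\<dots> \<le> (1 + \<epsilon>) * (fact p + real (N x) ^ p)"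
      using power_le_fact_exp[OF A(2), of x p] \<epsilon> unfolding mult.assoc
      by (intro mult_left_mono) (auto intro: add_increasing2)
    finally show ?thesis .
  qed
  have it: "integrable M (\<lambda>x. (1 - t n x) * V x)" if "V \<in> \<V>" for V n
    using t tM V that by (intro integrable_bounded_mult[where C=1]) auto
  have itN: "integrable M (\<lambda>x. (1 - t (N x) x) * V x)" if "V \<in> \<V>" for V
    using t measurable_from_subalg[OF H(1) tN] V that by (intro integrable_bounded_mult[where C=1]) auto
  have elim: "AE x in M. (\<lambda>n. e V n x) \<longlonglongrightarrow> 0" if "V \<in> \<V>" for V
    unfolding e_def
  proof (rule real_cond_exp_dominated_zero[where g="\<lambda>x. \<bar>V x\<bar>"])
    show "\<bar>(1 - t (Suc n) x) * V x\<bar> \<le> \<bar>(1 - t n x) * V x\<bar>" for n x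
      using t by (auto simp: abs_mult t_def intro!: mult_right_mono)
    show "\<bar>(1 - t n x) * V x\<bar> \<le> \<bar>V x\<bar>" for n x
      using t(2,3) by (simp add: abs_mult mult_left_le_one_le)
    show "(\<lambda>n. (1 - t n x) * V x) \<longlonglongrightarrow> 0" for x
    proof (rule tendsto_eventually)
      obtain k :: nat where "A x \<le> real k" using real_arch_simple by blast
      then show "\<forall>\<^sub>F n in sequentially. (1 - t n x) * V x = 0"
        by (intro eventually_sequentiallyI[of k]) (auto simp: t_def)
    qed
  qed (use V that tM in auto)
  have eN: "AE x in M. ?E (\<lambda>x. (1 - t (N x) x) * V x) x = e V (N x) x" if "V \<in> \<V>" for V
    unfolding e_def by (rule real_cond_exp_random_index[OF N it[OF that] itN[OF that]])
  have e0: "AE x in M. q V x = 0 \<longrightarrow> (\<forall>n. e V n x = 0)" if Vin: "V \<in> \<V>" for V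
  proof -
    let ?B = "\<lambda>x. if q V x = 0 then 1 else 0 :: real"
    have "AE x in M. q V x = 0 \<longrightarrow> w x * (V x * V x) = 0"
      unfolding q_def
      by (rule AE_zero_where_real_cond_exp_zero) (use iwVV Vin w0 in \<open>auto simp: less_imp_le\<close>)
    then have BV: "AE x in M. q V x = 0 \<longrightarrow> V x = 0"
      by eventually_elim (use wn0 in auto)
    have "AE x in M. q V x = 0 \<longrightarrow> e V n x = 0" for n
    proof -
      have "?B \<in> borel_measurable M" by (rule measurable_sub) measurable
      then have "(\<lambda>x. ?B x * ((1 - t n x) * V x)) \<in> borel_measurable M"
        using V(2)[OF Vin] tM[of n] by measurable
      moreover have "AE x in M. ?B x * ((1 - t n x) * V x) = 0" using BV by eventually_elim auto
      ultimately have "AE x in M. ?E (\<lambda>x. ?B x * ((1 - t n x) * V x)) x = ?E (\<lambda>x. 0) x"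
        by (intro real_cond_exp_cong) simp_all
      moreover have "AE x in M. ?E (\<lambda>x. 0) x = 0" by (rule real_cond_exp_F_meas) auto
      moreover have "AE x in M. ?E (\<lambda>x. ?B x * ((1 - t n x) * V x)) x = ?B x * e V n x"
        unfolding e_def by (rule real_cond_exp_bounded_mult[where C=1]) (use it Vin in auto)
      ultimately show ?thesis by (elim AE_mp) (auto intro!: AE_I2 split: if_splits)
    qed
    then show ?thesis by (simp add: AE_all_countable flip: all_simps)
  qed
  have good: "AE x in M. good (N x) x"
  proof -
    have "AE x in M. \<forall>V\<in>\<V>. (\<lambda>n. e V n x) \<longlonglongrightarrow> 0"
      using elim \<V> by (intro AE_finite_allI) auto
    then show ?thesis
    proof (rule AE_mp, intro AE_I2 impI)
      fix x assume *: "\<forall>V\<in>\<V>. (\<lambda>n. e V n x) \<longlonglongrightarrow> 0"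
      have "(\<lambda>n. \<Sum>V\<in>\<V>. \<bar>\<theta> V n x\<bar>) \<longlonglongrightarrow> (\<Sum>V\<in>\<V>. 0)"
        using * by (intro tendsto_sum tendsto_rabs_zero) (auto simp: \<theta>_def intro!: tendsto_divide_zero)
      then have "eventually (\<lambda>n. (\<Sum>V\<in>\<V>. \<bar>\<theta> V n x\<bar>) < \<delta>) sequentially"
        using \<delta>(1) by (intro order_tendstoD) auto
      then have "eventually (\<lambda>n. n0 \<le> n \<and> good n x) sequentially"
        using eventually_ge_at_top[of n0] by eventually_elim (auto simp: good_def)
      then have "\<exists>n. n0 \<le> n \<and> good n x" by (auto simp: eventually_sequentially)
      then have "n0 \<le> K x \<and> good (K x) x" unfolding K_def by (rule LeastI_ex)
      then show "good (N x) x" by (auto simp: N_def max_def)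
    qed
  qed
  have zV: "AE x in M. ?E (\<lambda>x. (z x - 1) * V x) x = 0" if Vin: "V \<in> \<V>" for V
  proof -
    have eq: "(\<lambda>x. (z x - 1) * V x) =
       (\<lambda>x. (- 1) * ((1 - t (N x) x) * V x) + (\<Sum>V'\<in>\<V>. \<mu> V' x * (w x * (V' x * V x))))"
      unfolding z_def u_def by (auto simp: algebra_simps sum_distrib_left)
    have "AE x in M. ?E (\<lambda>x. (z x - 1) * V x) x
       = (- 1) * ?E (\<lambda>x. (1 - t (N x) x) * V x) x + (\<Sum>V'\<in>\<V>. \<mu> V' x * ?E (\<lambda>x. w x * (V' x * V x)) x)"
      unfolding eq by (rule real_cond_exp_lincomb[where C=1]) (use \<V> itN Vin \<mu>1 iwVV in auto)
    moreover have "AE x in M. \<forall>V'\<in>\<V>. V' \<noteq> V \<longrightarrow> ?E (\<lambda>x. w x * (V' x * V x)) x = 0"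
      using orth Vin \<V> by (intro AE_finite_allI) auto
    ultimately show ?thesis using good e0[OF Vin] eN[OF Vin]
    proof (elim AE_mp, intro AE_I2 impI)
      fix x assume *: "?E (\<lambda>x. (z x - 1) * V x) x
       = (- 1) * ?E (\<lambda>x. (1 - t (N x) x) * V x) x + (\<Sum>V'\<in>\<V>. \<mu> V' x * ?E (\<lambda>x. w x * (V' x * V x)) x)"
        "\<forall>V'\<in>\<V>. V' \<noteq> V \<longrightarrow> ?E (\<lambda>x. w x * (V' x * V x)) x = 0"
        "good (N x) x" "q V x = 0 \<longrightarrow> (\<forall>n. e V n x = 0)"
        "?E (\<lambda>x. (1 - t (N x) x) * V x) x = e V (N x) x"
      have "(\<Sum>V'\<in>\<V>. \<mu> V' x * ?E (\<lambda>x. w x * (V' x * V x)) x)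
        = (\<Sum>V'\<in>\<V>. if V' = V then \<mu> V' x * ?E (\<lambda>x. w x * (V' x * V x)) x else 0)"
        using *(2) by (intro sum.cong) auto
      also have "\<dots> = \<mu> V x * q V x" using \<V> Vin by (simp add: q_def)
      also have "\<dots> = e V (N x) x" using *(3,4) by (auto simp: \<mu>_def \<theta>_def)
      finally show "?E (\<lambda>x. (z x - 1) * V x) x = 0" using *(1,5) by simp
    qed
  qed
  have zW: "AE x in M. ?E (\<lambda>x. (z x - 1) * W x) x = 0" if "W \<in> \<W>" for W
  proof -
    have "(\<lambda>x. z x - 1) \<in> borel_measurable M" using zM by simp
    from ker[THEN spec, THEN spec, THEN mp, THEN mp, THEN mp, THEN bspec, OF this _ _ that] bd zV
    show ?thesis by blast
  qed
  have z\<epsilon>: "z x \<le> 1 + \<epsilon>" for x using z1[of x] \<delta> by linarith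
  show thesis
    by (rule that[of z N, OF zH z0 z\<epsilon> zint N]) (fact zp, fact zW)
qed

end

section \<open>Finite horizon\<close>

text \<open>Conditional mean zero, tested against bounded functions rather than through the conditional
  expectation: this form survives a change of measure, since a bounded density that is known at the
  conditioning time is absorbed by the test function.\<close>

definition mean_zero_given :: "'a measure \<Rightarrow> 'a measure \<Rightarrow> ('a \<Rightarrow> real) \<Rightarrow> bool" where
  "mean_zero_given M G f \<longleftrightarrow> integrable M f \<and>
     (\<forall>g C. g \<in> borel_measurable G \<longrightarrow> (\<forall>x. \<bar>g x\<bar> \<le> C) \<longrightarrow> (\<integral>x. g x * f x \<partial>M) = 0)"

lemma mean_zero_givenD:
  assumes "mean_zero_given M G f" "g \<in> borel_measurable G" "\<And>x. \<bar>g x\<bar> \<le> C"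
  shows "(\<integral>x. g x * f x \<partial>M) = 0"
  using assms unfolding mean_zero_given_def by blast

lemma (in sigma_finite_subalgebra) integral_mult_cond_exp_zero:
  assumes "AE x in M. real_cond_exp M F f x = 0" "f \<in> borel_measurable M"
    and "g \<in> borel_measurable F" "integrable M (\<lambda>x. g x * f x)"
  shows "(\<integral>x. g x * f x \<partial>M) = 0"
proof -
  have "(\<integral>x. g x * f x \<partial>M) = (\<integral>x. g x * real_cond_exp M F f x \<partial>M)"
    using real_cond_exp_intg(2)[of g f] assms by simp
  also have "\<dots> = 0" using assms(1) by (intro integral_eq_zero_AE) auto
  finally show ?thesis .
qed

text \<open>\<open>\<Y> t\<close> holds the components of an integrable increment from time \<open>t\<close> to time \<open>Suc t\<close>.\<close>

locale martingale_differences = Q: prob_space Q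
  for Q :: "'a measure" +
  fixes F :: "nat \<Rightarrow> 'a measure" and \<Y> :: "nat \<Rightarrow> ('a \<Rightarrow> real) set"
  assumes filt: "filtration (space Q) F" and sub: "\<And>t. subalgebra Q (F t)"
    and fin: "\<And>t. finite (\<Y> t)"
    and meas: "\<And>t f. f \<in> \<Y> t \<Longrightarrow> f \<in> borel_measurable (F (Suc t))"
    and zero: "\<And>t f. f \<in> \<Y> t \<Longrightarrow> mean_zero_given Q (F t) f"
begin

lemma sub_mono: "s \<le> t \<Longrightarrow> subalgebra (F t) (F s)"
  using filt by (auto simp: subalgebra_def filtration_def)

lemma meas_mono: "s \<le> t \<Longrightarrow> f \<in> borel_measurable (F s) \<Longrightarrow> f \<in> borel_measurable (F t)"
  by (rule measurable_from_subalg[OF sub_mono])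

lemma meas_Q: "f \<in> borel_measurable (F s) \<Longrightarrow> f \<in> borel_measurable Q"
  by (rule measurable_from_subalg[OF sub])

lemma int: "f \<in> \<Y> t \<Longrightarrow> integrable Q f" using zero by (auto simp: mean_zero_given_def)

text \<open>Backward recursion over the time at which \<open>A\<close> is known. If this is \<open>Suc k\<close>, the factor \<open>z\<close> of the
  last step bounds the powers of \<open>A\<close> by powers of a level \<open>N\<close> known at time \<open>k\<close>, and the induction
  hypothesis gives a factor \<open>y\<close>, also known at time \<open>k\<close>, that makes the powers of \<open>N\<close> integrable. The
  product \<open>z * y\<close> inherits the conditions from \<open>y\<close>: the factor \<open>z\<close> changes neither the integral of a
  function known at time \<open>k\<close> (by the constraint \<open>W = 1\<close>) nor that of such a function times an increment
  from \<open>\<Y> k\<close> (by the other constraints), and for later increments it is part of the test function.\<close>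

lemma finite_horizon_density:
  fixes A :: "'a \<Rightarrow> real" and R :: "'a measure"
  assumes R: "prob_space R" "sets R = sets Q"
    and "A \<in> borel_measurable (F k)" "\<And>x. 0 \<le> A x" "0 < \<epsilon>"
  shows "\<exists>z\<in>borel_measurable (F k). (\<forall>x. 0 < z x \<and> z x \<le> 1 + \<epsilon>) \<and> (\<integral>x. \<bar>z x - 1\<bar> \<partial>R) \<le> \<epsilon> \<and>
     (\<integral>x. z x \<partial>Q) = 1 \<and>
     (\<forall>t. \<forall>f\<in>\<Y> t. mean_zero_given Q (F t) (\<lambda>x. z x * f x)) \<and>
     (\<forall>p. integrable Q (\<lambda>x. z x * A x ^ p))"
  using assms(3-)
proof (induction k arbitrary: A \<epsilon>)
  case (0 A \<epsilon>)
  \<comment> \<open>The step before time \<open>0\<close> conditions on the trivial \<open>\<sigma>\<close>-algebra, so that the level \<open>N\<close> is constant.\<close>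
  define G where "G = sigma (space Q) {}"
  have spG: "space G = space Q" by (simp add: G_def)
  have setsG: "sets G = {{}, space Q}" by (simp add: G_def sigma_sets_empty_eq)
  have subG: "subalgebra Q G" "subalgebra (F 0) G"
    using sub[of 0] sets.top[of "F 0"] by (auto simp: subalgebra_def setsG spG)
  interpret G: finite_measure_subalgebra Q G by standard (rule subG)
  obtain z N where z: "z \<in> borel_measurable (F 0)" "\<And>x. 0 < z x" "\<And>x. z x \<le> 1 + \<epsilon>"
    and zR: "(\<integral>x. \<bar>z x - 1\<bar> \<partial>R) \<le> \<epsilon>"
    and N: "N \<in> measurable G (count_space UNIV)"
    and zA: "\<And>p x. z x * (A x + 1) ^ p \<le> (1 + \<epsilon>) * (fact p + real (N x) ^ p)"
    and E: "\<And>W. W \<in> {\<lambda>_. 1} \<Longrightarrow> AE x in Q. real_cond_exp Q G (\<lambda>x. (z x - 1) * W x) x = 0"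
  proof (rule G.moment_preserving_damping[OF sub subG(2) _ _ _ _ R \<open>0 < \<epsilon>\<close>, of "\<lambda>x. A x + 1" "{\<lambda>_. 1}"])
    show "(\<lambda>x. A x + 1) \<in> borel_measurable (F 0)" using 0 by simp
    show "0 \<le> A x + 1" for x using 0(2)[of x] by linarith
  qed (use 0 in auto)
  have zQ: "z \<in> borel_measurable Q" using meas_Q z(1) .
  have iz: "integrable Q z"
    using z less_imp_le[OF z(2)] zQ by (intro Q.integrable_const_bound[where B="1 + \<epsilon>"]) auto
  have "(\<integral>x. 1 * ((z x - 1) * 1) \<partial>Q) = 0"
    using E iz zQ by (intro G.integral_mult_cond_exp_zero) auto
  then have z_int: "(\<integral>x. z x \<partial>Q) = 1" using iz Q.prob_space by simp
  obtain x0 where x0: "x0 \<in> space Q" using Q.not_empty by auto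
  have Nc: "N x = N x0" if "x \<in> space Q" for x
  proof -
    have "N -` {N x0} \<inter> space G \<in> sets G" using N by (rule measurable_sets) simp
    then have "N -` {N x0} \<inter> space Q = space Q" using x0 by (auto simp: setsG spG)
    then show ?thesis using that by auto
  qed
  have "integrable Q (\<lambda>x. z x * A x ^ p)" for p
  proof (rule Q.integrable_const_bound)
    show "AE x in Q. norm (z x * A x ^ p) \<le> (1 + \<epsilon>) * (fact p + real (N x0) ^ p)"
    proof (rule AE_I2)
      fix x assume x: "x \<in> space Q"
      have "z x * A x ^ p \<le> z x * (A x + 1) ^ p"
        using z(2)[of x] 0(2)[of x] by (intro mult_left_mono power_mono) auto
      also have "\<dots> \<le> (1 + \<epsilon>) * (fact p + real (N x0) ^ p)" using zA[of x p] Nc[OF x] by simp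
      finally show "norm (z x * A x ^ p) \<le> (1 + \<epsilon>) * (fact p + real (N x0) ^ p)"
        using z(2)[of x] 0(2)[of x] by simp
    qed
    show "(\<lambda>x. z x * A x ^ p) \<in> borel_measurable Q" using zQ meas_Q[OF 0(1)] by measurable
  qed
  moreover have "mean_zero_given Q (F t) (\<lambda>x. z x * f x)" if f: "f \<in> \<Y> t" for t f
    unfolding mean_zero_given_def
  proof (intro conjI allI impI)
    show "integrable Q (\<lambda>x. z x * f x)"
      using integrable_bounded_mult[OF zQ _ int[OF f], of "1 + \<epsilon>"] less_imp_le[OF z(2)] z(3) by simp
    fix g :: "'a \<Rightarrow> real" and C :: real assume g: "g \<in> borel_measurable (F t)" "\<forall>x. \<bar>g x\<bar> \<le> C"
    have "(\<integral>x. (g x * z x) * f x \<partial>Q) = 0"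
    proof (rule mean_zero_givenD[OF zero[OF f], where C="C * (1 + \<epsilon>)"])
      show "(\<lambda>x. g x * z x) \<in> borel_measurable (F t)" using g meas_mono[OF le0 z(1)] by measurable
      show "\<bar>g x * z x\<bar> \<le> C * (1 + \<epsilon>)" for x
        using g(2)[rule_format, of x] z(2,3)[of x] unfolding abs_mult by (intro mult_mono) auto
    qed
    then show "(\<integral>x. g x * (z x * f x) \<partial>Q) = 0" by (simp add: mult.assoc)
  qed
  ultimately show ?case using z zR z_int by blast
next
  case (Suc k A \<epsilon>)
  define \<delta> where "\<delta> = min \<epsilon> 1 / 3"
  have \<delta>: "0 < \<delta>" "\<delta> < 1" "3 * \<delta> \<le> \<epsilon>" using Suc(4) by (auto simp: \<delta>_def min_def)
  interpret R: prob_space R by (rule R)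
  interpret G: finite_measure_subalgebra Q "F k" by standard (rule sub)
  define \<W> where "\<W> = insert (\<lambda>_. 1) (\<Y> k)"
  have \<W>: "finite \<W>" using fin by (simp add: \<W>_def)
  have Wm: "W \<in> borel_measurable (F (Suc k))" "integrable Q W" if "W \<in> \<W>" for W
    using that meas int by (auto simp: \<W>_def)
  define B where "B = (\<lambda>x. A x + (\<Sum>W\<in>\<W>. \<bar>W x\<bar>))"
  have Bm: "B \<in> borel_measurable (F (Suc k))"
    unfolding B_def using Suc(2) Wm(1)
    by (intro borel_measurable_add borel_measurable_sum borel_measurable_abs) auto
  have BA: "A x \<le> B x" for x by (simp add: B_def sum_nonneg)
  have B0: "0 \<le> B x" for x using BA[of x] Suc(3)[of x] by linarith
  have BW: "\<bar>W x\<bar> \<le> B x" if "W \<in> \<W>" for W x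
    using member_le_sum[of W \<W> "\<lambda>W. \<bar>W x\<bar>"] that \<W> Suc(3)[of x] by (auto simp: B_def)
  obtain z N where z: "z \<in> borel_measurable (F (Suc k))" "\<And>x. 0 < z x" "\<And>x. z x \<le> 1 + \<delta>"
    and zR: "(\<integral>x. \<bar>z x - 1\<bar> \<partial>R) \<le> \<delta>"
    and N: "N \<in> measurable (F k) (count_space UNIV)"
    and zB: "\<And>p x. z x * B x ^ p \<le> (1 + \<delta>) * (fact p + real (N x) ^ p)"
    and E: "\<And>W. W \<in> \<W> \<Longrightarrow> AE x in Q. real_cond_exp Q (F k) (\<lambda>x. (z x - 1) * W x) x = 0"
    by (rule G.moment_preserving_damping[OF sub sub_mono Bm B0 \<W> _ R \<delta>(1)]) (use Wm BW in auto)
  have "(\<lambda>x. real (N x)) \<in> borel_measurable (F k)" using N by measurable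
  from Suc.IH[OF this _ \<delta>(1)] obtain y where y: "y \<in> borel_measurable (F k)" "\<And>x. 0 < y x" "\<And>x. y x \<le> 1 + \<delta>"
    and yR: "(\<integral>x. \<bar>y x - 1\<bar> \<partial>R) \<le> \<delta>" and y_int: "(\<integral>x. y x \<partial>Q) = 1"
    and yY: "\<And>t f. f \<in> \<Y> t \<Longrightarrow> mean_zero_given Q (F t) (\<lambda>x. y x * f x)"
    and yN: "\<And>p. integrable Q (\<lambda>x. y x * real (N x) ^ p)"
    by auto
  have zb: "\<bar>z x\<bar> \<le> 2" "\<bar>y x\<bar> \<le> 2" "\<bar>z x - 1\<bar> \<le> 2" "\<bar>y x - 1\<bar> \<le> 2" for x
    using z(2,3)[of x] y(2,3)[of x] \<delta> by (auto simp: abs_le_iff)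
  have zQ: "z \<in> borel_measurable Q" and yQ: "y \<in> borel_measurable Q"
    using meas_Q z(1) y(1) by auto
  have zRm: "z \<in> borel_measurable R" and yRm: "y \<in> borel_measurable R"
    using zQ yQ measurable_cong_sets[OF R(2) refl] by auto
  have iy: "integrable Q y" using yQ zb by (intro Q.integrable_const_bound[where B=2]) auto
  define v where "v = (\<lambda>x. z x * y x)"
  have vm: "v \<in> borel_measurable (F (Suc k))"
    unfolding v_def using z(1) meas_mono[OF _ y(1), of "Suc k"] by (intro borel_measurable_times) auto
  have vQ: "v \<in> borel_measurable Q" using meas_Q vm .
  have v0: "0 < v x" for x using z y by (simp add: v_def)
  have v1: "v x \<le> 1 + \<epsilon>" for x
  proof -
    have "v x \<le> (1 + \<delta>) * (1 + \<delta>)"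
      unfolding v_def using z(2,3)[of x] y(2,3)[of x] \<delta> by (intro mult_mono) auto
    also have "\<dots> \<le> 1 + 3 * \<delta>" using mult_left_le[of \<delta> \<delta>] \<delta> by (simp add: algebra_simps)
    finally show ?thesis using \<delta> by linarith
  qed
  have vR: "(\<integral>x. \<bar>v x - 1\<bar> \<partial>R) \<le> \<epsilon>"
  proof -
    have i: "integrable R (\<lambda>x. \<bar>z x - 1\<bar>)" "integrable R (\<lambda>x. \<bar>y x - 1\<bar>)"
      using zRm yRm zb by (auto intro!: R.integrable_const_bound[where B=2])
    have "(\<integral>x. \<bar>v x - 1\<bar> \<partial>R) \<le> (\<integral>x. (1 + \<delta>) * \<bar>z x - 1\<bar> + \<bar>y x - 1\<bar> \<partial>R)"
    proof (rule integral_mono')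
      show "integrable R (\<lambda>x. (1 + \<delta>) * \<bar>z x - 1\<bar> + \<bar>y x - 1\<bar>)" using i by auto
      fix x
      have "v x - 1 = y x * (z x - 1) + (y x - 1)" by (simp add: v_def algebra_simps)
      then have "\<bar>v x - 1\<bar> \<le> y x * \<bar>z x - 1\<bar> + \<bar>y x - 1\<bar>"
        using abs_triangle_ineq[of "y x * (z x - 1)" "y x - 1"] y(2)[of x] by (simp add: abs_mult)
      also have "\<dots> \<le> (1 + \<delta>) * \<bar>z x - 1\<bar> + \<bar>y x - 1\<bar>"
        using y(3)[of x] by (intro add_right_mono mult_right_mono) auto
      finally show "\<bar>v x - 1\<bar> \<le> (1 + \<delta>) * \<bar>z x - 1\<bar> + \<bar>y x - 1\<bar>" .
    qed (use \<delta> in simp)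
    also have "\<dots> = (1 + \<delta>) * (\<integral>x. \<bar>z x - 1\<bar> \<partial>R) + (\<integral>x. \<bar>y x - 1\<bar> \<partial>R)" using i by simp
    also have "\<dots> \<le> (1 + \<delta>) * \<delta> + \<delta>" using zR yR \<delta> by (intro add_mono mult_left_mono) auto
    also have "\<dots> \<le> 3 * \<delta>" using mult_left_le[of \<delta> \<delta>] \<delta> by (simp add: algebra_simps)
    finally show ?thesis using \<delta> by linarith
  qed
  have swap: "(\<integral>x. h x * (z x * W x) \<partial>Q) = (\<integral>x. h x * W x \<partial>Q)"
    if W: "W \<in> \<W>" and h: "h \<in> borel_measurable (F k)" "integrable Q (\<lambda>x. h x * W x)" for W h
  proof -
    have i: "integrable Q (\<lambda>x. (z x - 1) * (h x * W x))"
      using zQ by (intro integrable_bounded_mult[OF _ zb(3) h(2)]) simp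
    have "(\<integral>x. h x * ((z x - 1) * W x) \<partial>Q) = 0"
      using E[OF W] zQ Wm[OF W] h i
      by (intro G.integral_mult_cond_exp_zero) (auto simp: mult_ac)
    moreover have "(\<integral>x. h x * (z x * W x) \<partial>Q) = (\<integral>x. (z x - 1) * (h x * W x) + h x * W x \<partial>Q)"
      by (simp add: algebra_simps)
    ultimately show ?thesis using i h by (simp add: mult_ac)
  qed
  have v_int: "(\<integral>x. v x \<partial>Q) = 1"
    using swap[of "\<lambda>_. 1" y] y(1) iy y_int by (simp add: \<W>_def v_def mult.commute)
  have vA: "integrable Q (\<lambda>x. v x * A x ^ p)" for p
  proof (rule Bochner_Integration.integrable_bound)
    show "integrable Q (\<lambda>x. (1 + \<delta>) * (fact p * y x + y x * real (N x) ^ p))"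
      using iy yN by auto
    show "(\<lambda>x. v x * A x ^ p) \<in> borel_measurable Q" using vQ meas_Q[OF Suc(2)] by measurable
    have "\<bar>v x * A x ^ p\<bar> \<le> \<bar>(1 + \<delta>) * (fact p * y x + y x * real (N x) ^ p)\<bar>" for x
    proof -
      have "v x * A x ^ p \<le> y x * (z x * B x ^ p)"
        unfolding v_def using z(2)[of x] y(2)[of x] BA[of x] Suc(3)[of x]
        by (auto simp: mult_ac intro!: mult_left_mono power_mono)
      also have "\<dots> \<le> y x * ((1 + \<delta>) * (fact p + real (N x) ^ p))"
        using zB y(2)[of x] by (intro mult_left_mono) auto
      also have "\<dots> = (1 + \<delta>) * (fact p * y x + y x * real (N x) ^ p)" by (simp add: algebra_simps)
      finally show ?thesis using v0[of x] Suc(3)[of x] by (simp add: abs_of_nonneg)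
    qed
    then show "AE x in Q. norm (v x * A x ^ p) \<le> norm ((1 + \<delta>) * (fact p * y x + y x * real (N x) ^ p))"
      by simp
  qed
  have vY: "mean_zero_given Q (F t) (\<lambda>x. v x * f x)" if f: "f \<in> \<Y> t" for t f
    unfolding mean_zero_given_def
  proof (intro conjI allI impI)
    have iyf: "integrable Q (\<lambda>x. y x * f x)" using yY[OF f] by (simp add: mean_zero_given_def)
    show "integrable Q (\<lambda>x. v x * f x)"
      using integrable_bounded_mult[OF zQ zb(1) iyf] by (simp add: v_def mult.assoc)
    fix g :: "'a \<Rightarrow> real" and C :: real assume g: "g \<in> borel_measurable (F t)" "\<forall>x. \<bar>g x\<bar> \<le> C"
    have iygf: "integrable Q (\<lambda>x. g x * (y x * f x))"
      using integrable_bounded_mult[OF meas_Q[OF g(1)] _ iyf] g(2) by blast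
    have ygf0: "(\<integral>x. g x * (y x * f x) \<partial>Q) = 0" using mean_zero_givenD[OF yY[OF f] g(1)] g(2) by blast
    consider "t < k" | "t = k" | "k < t" by linarith
    then show "(\<integral>x. g x * (v x * f x) \<partial>Q) = 0"
    proof cases
      case 1
      let ?h = "\<lambda>x. g x * (y x * f x)"
      have "?h \<in> borel_measurable (F k)"
        using meas_mono[OF _ g(1), of k] y(1) meas_mono[OF _ meas[OF f], of k] 1
        by (intro borel_measurable_times) auto
      then have "(\<integral>x. ?h x * (z x * 1) \<partial>Q) = (\<integral>x. ?h x * 1 \<partial>Q)"
        using iygf by (intro swap) (auto simp: \<W>_def)
      then show ?thesis using ygf0 by (simp add: v_def mult_ac)
    next
      case 2
      have "(\<integral>x. (g x * y x) * (z x * f x) \<partial>Q) = (\<integral>x. (g x * y x) * f x \<partial>Q)"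
        using iygf f g(1) y(1) 2 by (intro swap) (auto simp: \<W>_def mult.assoc)
      then show ?thesis using ygf0 by (simp add: v_def mult_ac)
    next
      case 3
      have "(\<integral>x. (g x * z x) * (y x * f x) \<partial>Q) = 0"
      proof (rule mean_zero_givenD[OF yY[OF f], where C="C * 2"])
        show "(\<lambda>x. g x * z x) \<in> borel_measurable (F t)"
          using g(1) meas_mono[OF _ z(1), of t] 3 by (intro borel_measurable_times) auto
        show "\<bar>g x * z x\<bar> \<le> C * 2" for x
          using g(2)[rule_format, of x] zb(1)[of x] unfolding abs_mult by (intro mult_mono) auto
      qed
      then show ?thesis by (simp add: v_def mult_ac)
    qed
  qed
  show ?case using vm v0 v1 vR v_int vY vA by blast
qed

end

section \<open>Infinite horizon\<close>

context martingale_differences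
begin

text \<open>The finite horizon result applies under the measure with density \<open>D\<close>, because integrals under this
  measure are integrals of \<open>D\<close>-multiples under \<open>Q\<close>; the original \<open>Q\<close> serves as the measure \<open>R\<close>.\<close>

lemma density_stage:
  fixes D X :: "'a \<Rightarrow> real"
  assumes D: "D \<in> borel_measurable (F n)" "\<And>x. 0 < D x" "\<And>x. D x \<le> C" "(\<integral>x. D x \<partial>Q) = 1"
    and DY: "\<And>t f. f \<in> \<Y> t \<Longrightarrow> mean_zero_given Q (F t) (\<lambda>x. D x * f x)"
    and X: "X \<in> borel_measurable (F n)" "\<And>x. 0 \<le> X x" and \<epsilon>: "0 < \<epsilon>"
  shows "\<exists>d\<in>borel_measurable (F n). (\<forall>x. 0 < d x \<and> d x \<le> 1 + \<epsilon>) \<and> (\<integral>x. \<bar>d x - 1\<bar> \<partial>Q) \<le> \<epsilon> \<and>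
     (\<integral>x. D x * d x \<partial>Q) = 1 \<and>
     (\<forall>t. \<forall>f\<in>\<Y> t. mean_zero_given Q (F t) (\<lambda>x. D x * d x * f x)) \<and>
     (\<forall>p. integrable Q (\<lambda>x. D x * d x * X x ^ p))"
proof -
  have DQ: "D \<in> borel_measurable Q" using meas_Q D(1) .
  have D0: "AE x in Q. 0 \<le> D x" using D(2) by (auto intro: less_imp_le)
  have iD: "integrable Q D"
    using DQ D(2,3) by (intro Q.integrable_const_bound[where B=C]) (auto simp: abs_of_pos)
  define Q' where "Q' = density Q D"
  have setsQ': "sets Q' = sets Q" and spaceQ': "space Q' = space Q" by (simp_all add: Q'_def)
  have intQ': "(\<integral>x. f x \<partial>Q') = (\<integral>x. D x * f x \<partial>Q)" if "f \<in> borel_measurable Q" for f :: "'a \<Rightarrow> real"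
    unfolding Q'_def using integral_density[OF that DQ D0] by simp
  have iQ': "integrable Q' f \<longleftrightarrow> integrable Q (\<lambda>x. D x * f x)" if "f \<in> borel_measurable Q" for f :: "'a \<Rightarrow> real"
    unfolding Q'_def using integrable_density[OF that DQ D0] by simp
  have mz: "mean_zero_given Q' (F t) f \<longleftrightarrow> mean_zero_given Q (F t) (\<lambda>x. D x * f x)"
    if f: "f \<in> borel_measurable Q" for t f
  proof -
    have "(\<integral>x. g x * f x \<partial>Q') = (\<integral>x. g x * (D x * f x) \<partial>Q)" if "g \<in> borel_measurable (F t)" for g
      using intQ'[of "\<lambda>x. g x * f x"] meas_Q[OF that] f by (simp add: mult_ac)
    then show ?thesis unfolding mean_zero_given_def using iQ'[OF f] by auto
  qed
  have fQ: "f \<in> borel_measurable Q" if "f \<in> \<Y> t" for f t using meas_Q[OF meas[OF that]] .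
  have "prob_space Q'"
  proof
    have "emeasure Q' (space Q') = (\<integral>\<^sup>+x. D x \<partial>Q)"
      using DQ unfolding Q'_def by (simp add: emeasure_density cong: nn_integral_cong)
    also have "\<dots> = 1" using nn_integral_eq_integral[OF iD D0] D(4) by simp
    finally show "emeasure Q' (space Q') = 1" .
  qed
  then interpret D: martingale_differences Q' F \<Y>
  proof (intro martingale_differences.intro martingale_differences_axioms.intro)
    show "filtration (space Q') F" using filt by (simp add: spaceQ')
    show "subalgebra Q' (F t)" for t using sub[of t] by (simp add: subalgebra_def setsQ' spaceQ')
    show "finite (\<Y> t)" for t by (rule fin)
    show "f \<in> borel_measurable (F (Suc t))" if "f \<in> \<Y> t" for t f using meas that .
    show "mean_zero_given Q' (F t) f" if "f \<in> \<Y> t" for t f using mz[OF fQ[OF that]] DY[OF that] by simp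
  qed
  obtain d where d: "d \<in> borel_measurable (F n)" "\<And>x. 0 < d x \<and> d x \<le> 1 + \<epsilon>"
    and dR: "(\<integral>x. \<bar>d x - 1\<bar> \<partial>Q) \<le> \<epsilon>" and d1: "(\<integral>x. d x \<partial>Q') = 1"
    and dY: "\<And>t f. f \<in> \<Y> t \<Longrightarrow> mean_zero_given Q' (F t) (\<lambda>x. d x * f x)"
    and dX: "\<And>p. integrable Q' (\<lambda>x. d x * X x ^ p)"
    using D.finite_horizon_density[OF Q.prob_space_axioms setsQ'[symmetric] X \<epsilon>] by blast
  have dQ: "d \<in> borel_measurable Q" and XQ: "X \<in> borel_measurable Q" using meas_Q d(1) X(1) by auto
  have "mean_zero_given Q (F t) (\<lambda>x. D x * d x * f x)" if "f \<in> \<Y> t" for t f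
  proof -
    have "(\<lambda>x. d x * f x) \<in> borel_measurable Q" using dQ fQ[OF that] by measurable
    from mz[OF this] dY[OF that] show ?thesis by (simp add: mult.assoc)
  qed
  moreover have "integrable Q (\<lambda>x. D x * d x * X x ^ p)" for p
  proof -
    have "(\<lambda>x. d x * X x ^ p) \<in> borel_measurable Q" using dQ XQ by measurable
    from iQ'[OF this] dX show ?thesis by (simp add: mult.assoc)
  qed
  ultimately show ?thesis using d dR d1 intQ'[OF dQ] by auto
qed

text \<open>Stage \<open>n\<close> makes the powers of \<open>X n\<close> integrable; \<open>D (Suc n)\<close> is known already at time \<open>n\<close>, one step
  earlier than its index suggests.\<close>

lemma density_sequence:
  fixes X :: "nat \<Rightarrow> 'a \<Rightarrow> real"
  assumes X: "\<And>n. X n \<in> borel_measurable (F n)" "\<And>n x. 0 \<le> X n x" and \<epsilon>: "\<And>n. 0 < \<epsilon> n"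
  obtains D :: "nat \<Rightarrow> 'a \<Rightarrow> real"
  where "\<And>x. D 0 x = 1" "\<And>n x. 0 < D n x" "\<And>n x. D (Suc n) x \<le> (1 + \<epsilon> n) * D n x"
    and "\<And>n. D (Suc n) \<in> borel_measurable (F n)"
    and "\<And>n. (\<integral>x. \<bar>D (Suc n) x / D n x - 1\<bar> \<partial>Q) \<le> \<epsilon> n" "\<And>n. (\<integral>x. D n x \<partial>Q) = 1"
    and "\<And>n t f. f \<in> \<Y> t \<Longrightarrow> mean_zero_given Q (F t) (\<lambda>x. D n x * f x)"
    and "\<And>n p. integrable Q (\<lambda>x. D (Suc n) x * X n x ^ p)"
proof -
  define P where "P = (\<lambda>n D. D \<in> borel_measurable (F n) \<and> (\<forall>x. 0 < D x) \<and> (\<exists>C. \<forall>x. D x \<le> C) \<and>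
      (\<integral>x. D x \<partial>Q) = (1::real) \<and> (\<forall>t. \<forall>f\<in>\<Y> t. mean_zero_given Q (F t) (\<lambda>x. D x * f x)) \<and>
      (n = 0 \<longrightarrow> D = (\<lambda>x. 1)))"
  \<comment> \<open>Measurability of \<open>D'\<close> at time \<open>n\<close> belongs to the transition; the invariant \<open>P (Suc n)\<close> gives it only at
    time \<open>Suc n\<close>.\<close>
  define S where "S = (\<lambda>n D D'. D' \<in> borel_measurable (F n) \<and> (\<forall>x. D' x \<le> (1 + \<epsilon> n) * D x) \<and>
      (\<integral>x. \<bar>D' x / D x - 1\<bar> \<partial>Q) \<le> \<epsilon> n \<and> (\<forall>p. integrable Q (\<lambda>x. D' x * X n x ^ p)))"
  have "\<exists>D. \<forall>n. P n (D n) \<and> S n (D n) (D (Suc n))"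
  proof (rule dependent_nat_choice)
    show "\<exists>D. P 0 D"
      unfolding P_def using zero Q.prob_space by (intro exI[of _ "\<lambda>x. 1"]) auto
    fix D n assume "P n D"
    then obtain C where D: "D \<in> borel_measurable (F n)" "\<And>x. 0 < D x" "\<And>x. D x \<le> C" "(\<integral>x. D x \<partial>Q) = 1"
      and DY: "\<And>t f. f \<in> \<Y> t \<Longrightarrow> mean_zero_given Q (F t) (\<lambda>x. D x * f x)"
      unfolding P_def by blast
    obtain d where d: "d \<in> borel_measurable (F n)" "\<And>x. 0 < d x \<and> d x \<le> 1 + \<epsilon> n"
      "(\<integral>x. \<bar>d x - 1\<bar> \<partial>Q) \<le> \<epsilon> n" "(\<integral>x. D x * d x \<partial>Q) = 1"
      "\<And>t f. f \<in> \<Y> t \<Longrightarrow> mean_zero_given Q (F t) (\<lambda>x. D x * d x * f x)"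
      "\<And>p. integrable Q (\<lambda>x. D x * d x * X n x ^ p)"
      using density_stage[OF D DY X(1)[of n] X(2)[of n] \<epsilon>[of n]] by blast
    define D' where "D' = (\<lambda>x. D x * d x)"
    have "D' \<in> borel_measurable (F n)" unfolding D'_def using D(1) d(1) by measurable
    moreover have "D' x \<le> (1 + \<epsilon> n) * D x" for x
      using d(2)[of x] D(2)[of x] by (simp add: D'_def mult.commute)
    moreover have "D' x \<le> (1 + \<epsilon> n) * C" for x
      using calculation(2)[of x] D(3)[of x] \<epsilon>[of n] by (auto elim!: order_trans intro!: mult_left_mono)
    moreover have "0 < D' x" for x using d(2)[of x] D(2)[of x] by (simp add: D'_def)
    moreover have "D' x / D x = d x" for x using D(2)[of x] by (simp add: D'_def)
    ultimately have "P (Suc n) D' \<and> S n D D'"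
      unfolding P_def S_def using d meas_mono[of n "Suc n" D'] by (auto simp: D'_def)
    then show "\<exists>D'. P (Suc n) D' \<and> S n D D'" by (rule exI[of _ D'])
  qed
  then obtain D where "\<And>n. P n (D n)" "\<And>n. S n (D n) (D (Suc n))" by blast
  then show thesis unfolding P_def S_def by (intro that[of D]) auto
qed

end

lemma AE_summable_of_summable_integral:
  fixes f :: "nat \<Rightarrow> 'a \<Rightarrow> real"
  assumes f: "\<And>n. integrable M (f n)" "\<And>n. AE x in M. 0 \<le> f n x"
    and s: "summable (\<lambda>n. \<integral>x. f n x \<partial>M)"
  shows "AE x in M. summable (\<lambda>n. f n x)"
proof -
  have "(\<integral>\<^sup>+x. (\<Sum>n. ennreal (f n x)) \<partial>M) = (\<Sum>n. \<integral>\<^sup>+x. ennreal (f n x) \<partial>M)"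
    using f(1) by (intro nn_integral_suminf) auto
  also have "\<dots> = (\<Sum>n. ennreal (\<integral>x. f n x \<partial>M))"
    using f by (simp add: nn_integral_eq_integral)
  also have "\<dots> < \<infinity>"
    using s f(2) by (simp add: suminf_ennreal2 integral_nonneg_AE)
  finally have "(\<integral>\<^sup>+x. (\<Sum>n. ennreal (f n x)) \<partial>M) \<noteq> \<infinity>" by simp
  then have "AE x in M. (\<Sum>n. ennreal (f n x)) \<noteq> \<infinity>"
    using f(1) by (intro nn_integral_PInf_AE) auto
  moreover have "AE x in M. \<forall>n. 0 \<le> f n x" using f(2) by (simp add: AE_all_countable)
  ultimately show ?thesis
    by eventually_elim (auto intro: summable_suminf_not_top)
qed

context martingale_differences
begin

text \<open>The tolerances \<open>e n\<close> sum up to \<open>ln (1 + \<epsilon>)\<close>, so that the product of all factors \<open>1 + e n\<close> is at most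
  \<open>1 + \<epsilon>\<close>. They are geometric because not only the tolerances but also the tails of their series, which
  bound the distance of \<open>E (Suc t)\<close> from \<open>D\<close> in mean, have to be summable: this yields
  \<open>E[D|F t] - E (Suc t) \<rightarrow> 0\<close> almost surely, by the contraction property of conditional expectation.\<close>

lemma equivalent_density:
  fixes X :: "nat \<Rightarrow> 'a \<Rightarrow> real"
  assumes X: "\<And>n. X n \<in> borel_measurable (F n)" "\<And>n x. 0 \<le> X n x" and \<epsilon>: "0 < \<epsilon>"
  obtains D :: "'a \<Rightarrow> real"
  where "D \<in> borel_measurable Q" "\<And>x. 0 \<le> D x" "\<And>x. D x \<le> 1 + \<epsilon>" "AE x in Q. 0 < D x" "(\<integral>x. D x \<partial>Q) = 1"
    and "AE x in Q. (\<lambda>t. real_cond_exp Q (F t) D x) \<longlonglongrightarrow> D x"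
    and "\<And>t f. f \<in> \<Y> t \<Longrightarrow> mean_zero_given Q (F t) (\<lambda>x. D x * f x)"
    and "\<And>n p. integrable Q (\<lambda>x. D x * X n x ^ p)"
proof -
  define c where "c = ln (1 + \<epsilon>)"
  have c: "0 < c" "exp c = 1 + \<epsilon>" using \<epsilon> by (simp_all add: c_def)
  define e where "e = (\<lambda>n. c * (1 / 2) ^ Suc n)"
  have e0: "0 < e n" for n using c by (simp add: e_def)
  have esum: "(\<Sum>k<n. e k) = c * (1 - (1 / 2) ^ n)" for n
    by (induction n) (auto simp: e_def algebra_simps)
  obtain E :: "nat \<Rightarrow> 'a \<Rightarrow> real" where E0: "\<And>x. E 0 x = 1" and Epos: "\<And>n x. 0 < E n x"
    and Estep: "\<And>n x. E (Suc n) x \<le> (1 + e n) * E n x"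
    and Em: "\<And>n. E (Suc n) \<in> borel_measurable (F n)"
    and Ed: "\<And>n. (\<integral>x. \<bar>E (Suc n) x / E n x - 1\<bar> \<partial>Q) \<le> e n" and E1: "\<And>n. (\<integral>x. E n x \<partial>Q) = 1"
    and EY: "\<And>n t f. f \<in> \<Y> t \<Longrightarrow> mean_zero_given Q (F t) (\<lambda>x. E n x * f x)"
    and EX: "\<And>n p. integrable Q (\<lambda>x. E (Suc n) x * X n x ^ p)"
    by (rule density_sequence[OF X e0]) (rule that)
  have EQ[measurable]: "E n \<in> borel_measurable Q" for n
  proof (cases n)
    case 0
    then have "E n = (\<lambda>x. 1)" using E0 by auto
    then show ?thesis by simp
  next
    case (Suc k)
    then show ?thesis using meas_Q[OF Em[of k]] by simp
  qed
  have Eexp: "E (n + m) x \<le> exp (\<Sum>k<m. e (n + k)) * E n x" for n m x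
  proof (induction m)
    case (Suc m)
    have "E (n + Suc m) x \<le> (1 + e (n + m)) * E (n + m) x" using Estep by simp
    also have "\<dots> \<le> exp (e (n + m)) * (exp (\<Sum>k<m. e (n + k)) * E n x)"
      using Suc.IH e0[of "n + m"] Epos[of "n + m" x] by (intro mult_mono exp_ge_add_one_self) auto
    also have "\<dots> = exp (\<Sum>k<Suc m. e (n + k)) * E n x" by (simp add: exp_add)
    finally show ?case .
  qed simp
  have Ebd: "E (n + m) x \<le> (1 + \<epsilon>) * E n x" for n m x
  proof -
    have "(\<Sum>k<m. e (n + k)) \<le> (\<Sum>k<m. e k)"
      using c by (intro sum_mono) (auto simp: e_def power_add mult_left_le_one_le power_le_one)
    also have "\<dots> \<le> c" using c by (simp add: esum mult_left_le)
    finally have "exp (\<Sum>k<m. e (n + k)) \<le> 1 + \<epsilon>" unfolding c(2)[symmetric] by simp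
    then show ?thesis using Eexp[of n m x] Epos[of n x] by (meson less_imp_le mult_right_mono order_trans)
  qed
  have En0: "E n x \<noteq> 0" for n x using Epos[of n x] by simp
  have EC: "E n x \<le> 1 + \<epsilon>" for n x using Ebd[of 0 n x] E0 by simp
  define a where "a = (\<lambda>n x. \<bar>E (Suc n) x / E n x - 1\<bar>)"
  have a2: "a n x \<le> 2 + e n" for n x
  proof -
    have "E (Suc n) x / E n x \<le> 1 + e n" using Estep[of n x] Epos[of n x] by (simp add: field_simps)
    moreover have "0 < E (Suc n) x / E n x" using Epos by simp
    ultimately show ?thesis using e0[of n] by (simp add: a_def abs_le_iff)
  qed
  have ia: "integrable Q (a n)" for n
    using a2 by (intro Q.integrable_const_bound[where B="2 + e n"]) (auto simp: a_def)
  have se: "summable e" unfolding e_def using summable_geometric[of "1/2::real"] by (intro summable_mult) (simp add: summable_Suc_iff)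
  have "AE x in Q. summable (\<lambda>n. a n x)"
  proof (rule AE_summable_of_summable_integral[OF ia])
    show "summable (\<lambda>n. \<integral>x. a n x \<partial>Q)"
      by (rule summable_comparison_test'[OF se, of 0]) (use Ed in \<open>auto simp: a_def\<close>)
  qed (simp add: a_def)
  moreover have "\<exists>l>0. (\<lambda>n. E n x) \<longlonglongrightarrow> l" if s: "summable (\<lambda>n. a n x)" for x
  proof -
    define r where "r = (\<lambda>n. E (Suc n) x / E n x)"
    have r: "0 < r n" for n using Epos by (simp add: r_def)
    have "abs_convergent_prod r"
      unfolding abs_convergent_prod_conv_summable using s by (simp add: a_def r_def)
    then have cp: "convergent_prod r" by (rule abs_convergent_prod_imp_convergent_prod)
    have pr: "(\<Prod>i\<le>n. r i) = E (Suc n) x" for n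
      by (induction n) (use En0 E0 in \<open>auto simp: r_def\<close>)
    have "(\<lambda>n. E (Suc n) x) \<longlonglongrightarrow> prodinf r" using convergent_prod_LIMSEQ[OF cp] by (simp add: pr)
    then have lim: "(\<lambda>n. E n x) \<longlonglongrightarrow> prodinf r" by (rule LIMSEQ_imp_Suc)
    have "0 \<le> prodinf r" using lim Epos by (intro LIMSEQ_le_const) (auto intro: less_imp_le)
    moreover have "prodinf r \<noteq> 0" by (rule prodinf_nonzero[OF cp]) (use r in \<open>metis less_irrefl\<close>)
    ultimately show ?thesis using lim by (intro exI[of _ "prodinf r"]) auto
  qed
  ultimately have lim_ex: "AE x in Q. \<exists>l>0. (\<lambda>n. E n x) \<longlonglongrightarrow> l" by (auto elim: AE_mp)
  \<comment> \<open>Clipping the limit to its almost sure range makes the bounds on \<open>D\<close> hold everywhere.\<close>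
  define D where "D = (\<lambda>x. max 0 (min (1 + \<epsilon>) (lim (\<lambda>n. E n x))))"
  have DQ[measurable]: "D \<in> borel_measurable Q" unfolding D_def by measurable
  have D0: "0 \<le> D x" and DC: "D x \<le> 1 + \<epsilon>" for x using \<epsilon> by (auto simp: D_def)
  have Dlim: "AE x in Q. 0 < D x \<and> (\<lambda>n. E n x) \<longlonglongrightarrow> D x"
    using lim_ex
  proof eventually_elim
    case (elim x)
    then obtain l where l: "0 < l" "(\<lambda>n. E n x) \<longlonglongrightarrow> l" by auto
    then have "l \<le> 1 + \<epsilon>" using EC by (intro LIMSEQ_le_const2) auto
    then show ?case using l by (simp add: D_def limI)
  qed
  have limE: "AE x in Q. (\<lambda>n. E n x) \<longlonglongrightarrow> D x" using Dlim by auto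
  have iD: "integrable Q D" using D0 DC by (intro Q.integrable_const_bound[where B="1 + \<epsilon>"]) auto
  have iE: "integrable Q (E n)" for n
    using Epos EC by (intro Q.integrable_const_bound[where B="1 + \<epsilon>"]) (auto simp: abs_of_pos)
  have D1: "(\<integral>x. D x \<partial>Q) = 1"
  proof (rule LIMSEQ_unique)
    show "(\<lambda>n. \<integral>x. E n x \<partial>Q) \<longlonglongrightarrow> (\<integral>x. D x \<partial>Q)"
      using limE Epos EC
      by (intro integral_dominated_convergence[where w="\<lambda>_. 1 + \<epsilon>"]) (auto simp: abs_of_pos)
  qed (simp add: E1)
  have DE: "AE x in Q. D x \<le> (1 + \<epsilon>) * E n x" for n
    using limE
  proof eventually_elim
    case (elim x)
    show ?case
      by (rule LIMSEQ_le_const2[OF elim])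
        (use Ebd[of n] in \<open>auto intro!: exI[of _ n] simp: le_iff_add\<close>)
  qed
  have dDE: "(\<integral>x. \<bar>D x - E n x\<bar> \<partial>Q) \<le> (1 + \<epsilon>) * c * (1 / 2) ^ n" for n
  proof -
    have iEE: "integrable Q (\<lambda>x. \<bar>E (n + m) x - E n x\<bar>)" for m using iE by auto
    have 1: "(\<integral>x. \<bar>E (Suc k) x - E k x\<bar> \<partial>Q) \<le> (1 + \<epsilon>) * e k" for k
    proof -
      have "(\<integral>x. \<bar>E (Suc k) x - E k x\<bar> \<partial>Q) \<le> (\<integral>x. (1 + \<epsilon>) * a k x \<partial>Q)"
      proof (rule integral_mono)
        fix x
        have "E (Suc k) x - E k x = E k x * (E (Suc k) x / E k x - 1)"
          using Epos[of k x] by (simp add: field_simps)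
        then have "\<bar>E (Suc k) x - E k x\<bar> = E k x * a k x" using Epos[of k x] by (simp add: a_def abs_mult)
        also have "\<dots> \<le> (1 + \<epsilon>) * a k x" using EC by (intro mult_right_mono) (auto simp: a_def)
        finally show "\<bar>E (Suc k) x - E k x\<bar> \<le> (1 + \<epsilon>) * a k x" .
      qed (use iE ia in auto)
      also have "\<dots> \<le> (1 + \<epsilon>) * e k" using Ed[of k] \<epsilon> by (simp add: a_def)
      finally show ?thesis .
    qed
    have "(\<integral>x. \<bar>E (n + m) x - E n x\<bar> \<partial>Q) \<le> (1 + \<epsilon>) * (\<Sum>k<m. e (n + k))" for m
    proof (induction m)
      case (Suc m)
      have "(\<integral>x. \<bar>E (n + Suc m) x - E n x\<bar> \<partial>Q)
         \<le> (\<integral>x. \<bar>E (Suc (n + m)) x - E (n + m) x\<bar> + \<bar>E (n + m) x - E n x\<bar> \<partial>Q)"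
        using iE by (intro integral_mono) auto
      also have "\<dots> = (\<integral>x. \<bar>E (Suc (n + m)) x - E (n + m) x\<bar> \<partial>Q) + (\<integral>x. \<bar>E (n + m) x - E n x\<bar> \<partial>Q)"
        using iE by simp
      also have "\<dots> \<le> (1 + \<epsilon>) * e (n + m) + (1 + \<epsilon>) * (\<Sum>k<m. e (n + k))"
        using 1 Suc.IH by (intro add_mono) auto
      finally show ?case by (simp add: algebra_simps)
    qed simp
    moreover have "(\<Sum>k<m. e (n + k)) \<le> c * (1 / 2) ^ n" for m
    proof -
      have "(\<Sum>k<m. e (n + k)) = (1 / 2) ^ n * (\<Sum>k<m. e k)"
        by (simp add: e_def power_add sum_distrib_left mult_ac)
      also have "\<dots> \<le> (1 / 2) ^ n * c" using c by (intro mult_left_mono) (auto simp: esum mult_left_le)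
      finally show ?thesis by (simp add: mult.commute)
    qed
    ultimately have le: "(\<integral>x. \<bar>E (n + m) x - E n x\<bar> \<partial>Q) \<le> (1 + \<epsilon>) * (c * (1 / 2) ^ n)" for m
      using \<epsilon> by (meson add_nonneg_nonneg less_imp_le mult_left_mono order_trans zero_le_one)
    have "(\<lambda>m. \<integral>x. \<bar>E (n + m) x - E n x\<bar> \<partial>Q) \<longlonglongrightarrow> (\<integral>x. \<bar>D x - E n x\<bar> \<partial>Q)"
    proof (rule integral_dominated_convergence[where w="\<lambda>_. 1 + \<epsilon>"])
      show "AE x in Q. (\<lambda>m. \<bar>E (n + m) x - E n x\<bar>) \<longlonglongrightarrow> \<bar>D x - E n x\<bar>"
        using limE
      proof eventually_elim
        case (elim x)
        have "(\<lambda>m. E (n + m) x) \<longlonglongrightarrow> D x"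
          using LIMSEQ_ignore_initial_segment[OF elim, of n] by (simp add: add.commute)
        then show ?case by (intro tendsto_intros)
      qed
      have "\<bar>E (n + m) x - E n x\<bar> \<le> 1 + \<epsilon>" for m x
        using Epos[of n x] Epos[of "n + m" x] EC[of n x] EC[of "n + m" x] by (simp add: abs_le_iff)
      then show "AE x in Q. norm \<bar>E (n + m) x - E n x\<bar> \<le> 1 + \<epsilon>" for m by simp
    qed auto
    then have "(\<integral>x. \<bar>D x - E n x\<bar> \<partial>Q) \<le> (1 + \<epsilon>) * (c * (1 / 2) ^ n)"
      by (rule LIMSEQ_le_const2) (use le in auto)
    then show ?thesis by (simp add: mult.assoc)
  qed
  let ?Z = "\<lambda>t x. real_cond_exp Q (F t) D x"
  have Zlim: "AE x in Q. (\<lambda>t. ?Z t x) \<longlonglongrightarrow> D x"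
  proof -
    have G: "finite_measure_subalgebra Q (F t)" for t by standard (rule sub)
    have ZQ: "integrable Q (?Z t)" for t
    proof -
      interpret G: finite_measure_subalgebra Q "F t" by (rule G)
      show ?thesis using iD by (intro G.real_cond_exp_int)
    qed
    have iZE: "integrable Q (\<lambda>x. \<bar>?Z t x - E (Suc t) x\<bar>)" for t using ZQ iE by auto
    have le: "(\<integral>x. \<bar>?Z t x - E (Suc t) x\<bar> \<partial>Q) \<le> (1 + \<epsilon>) * c * (1 / 2) ^ Suc t" for t
    proof -
      interpret G: finite_measure_subalgebra Q "F t" by (rule G)
      have "AE x in Q. real_cond_exp Q (F t) (\<lambda>x. D x - E (Suc t) x) x = ?Z t x - real_cond_exp Q (F t) (E (Suc t)) x"
        using iD iE by (rule G.real_cond_exp_diff)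
      moreover have "AE x in Q. real_cond_exp Q (F t) (E (Suc t)) x = E (Suc t) x"
        using iE Em by (rule G.real_cond_exp_F_meas)
      ultimately have "AE x in Q. real_cond_exp Q (F t) (\<lambda>x. D x - E (Suc t) x) x = ?Z t x - E (Suc t) x"
        by eventually_elim auto
      then have "(\<integral>x. \<bar>?Z t x - E (Suc t) x\<bar> \<partial>Q) = (\<integral>x. \<bar>real_cond_exp Q (F t) (\<lambda>x. D x - E (Suc t) x) x\<bar> \<partial>Q)"
        by (intro integral_cong_AE) auto
      also have "\<dots> \<le> (\<integral>x. \<bar>D x - E (Suc t) x\<bar> \<partial>Q)"
        using iD iE by (intro G.integral_abs_real_cond_exp_le) auto
      also have "\<dots> \<le> (1 + \<epsilon>) * c * (1 / 2) ^ Suc t" by (rule dDE)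
      finally show ?thesis .
    qed
    have "AE x in Q. summable (\<lambda>t. \<bar>?Z t x - E (Suc t) x\<bar>)"
    proof (rule AE_summable_of_summable_integral[OF iZE])
      have "summable (\<lambda>t. (1 + \<epsilon>) * c * (1 / 2) ^ Suc t)"
        using summable_geometric[of "1/2::real"] by (intro summable_mult) (simp add: summable_Suc_iff)
      then show "summable (\<lambda>t. \<integral>x. \<bar>?Z t x - E (Suc t) x\<bar> \<partial>Q)"
        by (rule summable_comparison_test'[of _ 0]) (use le in auto)
    qed simp
    then show ?thesis using limE
    proof eventually_elim
      case (elim x)
      have "(\<lambda>t. ?Z t x - E (Suc t) x) \<longlonglongrightarrow> 0"
        using summable_LIMSEQ_zero[OF elim(1)] by (simp add: tendsto_rabs_zero_iff)
      moreover have "(\<lambda>t. E (Suc t) x) \<longlonglongrightarrow> D x" using elim(2) by (rule LIMSEQ_Suc)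
      ultimately have "(\<lambda>t. (?Z t x - E (Suc t) x) + E (Suc t) x) \<longlonglongrightarrow> 0 + D x" by (rule tendsto_add)
      then show ?case by simp
    qed
  qed
  have DY: "mean_zero_given Q (F t) (\<lambda>x. D x * f x)" if f: "f \<in> \<Y> t" for t f
    unfolding mean_zero_given_def
  proof (intro conjI allI impI)
    have i: "integrable Q f" using int[OF f] .
    show "integrable Q (\<lambda>x. D x * f x)" using integrable_bounded_mult[OF DQ _ i, of "1 + \<epsilon>"] D0 DC by simp
    fix g :: "'a \<Rightarrow> real" and C :: real assume g: "g \<in> borel_measurable (F t)" "\<forall>x. \<bar>g x\<bar> \<le> C"
    have gQ[measurable]: "g \<in> borel_measurable Q" using meas_Q g(1) .
    have fQ[measurable]: "f \<in> borel_measurable Q" using i by auto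
    have C0: "0 \<le> C" using order_trans[OF abs_ge_zero g(2)[rule_format]] .
    show "(\<integral>x. g x * (D x * f x) \<partial>Q) = 0"
    proof (rule LIMSEQ_unique)
      show "(\<lambda>n. \<integral>x. g x * (E n x * f x) \<partial>Q) \<longlonglongrightarrow> (\<integral>x. g x * (D x * f x) \<partial>Q)"
      proof (rule integral_dominated_convergence[where w="\<lambda>x. C * ((1 + \<epsilon>) * \<bar>f x\<bar>)"])
        show "integrable Q (\<lambda>x. C * ((1 + \<epsilon>) * \<bar>f x\<bar>))" using i by auto
        show "AE x in Q. (\<lambda>n. g x * (E n x * f x)) \<longlonglongrightarrow> g x * (D x * f x)"
          using limE by eventually_elim (intro tendsto_intros)
        have "\<bar>g x * (E n x * f x)\<bar> \<le> C * ((1 + \<epsilon>) * \<bar>f x\<bar>)" for n x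
          using g(2)[rule_format, of x] EC[of n x] Epos[of n x] C0 unfolding abs_mult
          by (intro mult_mono) (auto simp: abs_of_pos)
        then show "AE x in Q. norm (g x * (E n x * f x)) \<le> C * ((1 + \<epsilon>) * \<bar>f x\<bar>)" for n by simp
      qed auto
      have "(\<integral>x. g x * (E n x * f x) \<partial>Q) = 0" for n
        using mean_zero_givenD[OF EY[OF f] g(1)] g(2) by blast
      then show "(\<lambda>n. \<integral>x. g x * (E n x * f x) \<partial>Q) \<longlonglongrightarrow> 0" by simp
    qed
  qed
  have DX: "integrable Q (\<lambda>x. D x * X n x ^ p)" for n p
  proof (rule Bochner_Integration.integrable_bound)
    show "integrable Q (\<lambda>x. (1 + \<epsilon>) * (E (Suc n) x * X n x ^ p))" using EX by simp
    show "(\<lambda>x. D x * X n x ^ p) \<in> borel_measurable Q" using meas_Q[OF X(1)[of n]] by measurable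
    show "AE x in Q. norm (D x * X n x ^ p) \<le> norm ((1 + \<epsilon>) * (E (Suc n) x * X n x ^ p))"
      using DE[of "Suc n"]
    proof eventually_elim
      case (elim x)
      have "D x * X n x ^ p \<le> (1 + \<epsilon>) * E (Suc n) x * X n x ^ p"
        using elim X(2)[of n x] by (intro mult_right_mono) auto
      then show ?case using D0[of x] X(2)[of n x] Epos[of "Suc n" x] \<epsilon> by (simp add: mult.assoc abs_of_nonneg)
    qed
  qed
  have "AE x in Q. 0 < D x" using Dlim by auto
  then show thesis using that[OF DQ D0 DC _ D1 Zlim DY DX] by blast
qed

end

section \<open>Local martingales\<close>

lemma enat_tendsto_infinity_eventually:
  assumes "(\<lambda>n. a n) \<longlonglongrightarrow> (\<infinity>::enat)"
  shows "\<forall>\<^sub>F n in sequentially. enat t < a n"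
  using order_tendstoD(1)[OF assms, of "enat t"] by simp

lemma euclidean_cond_exp_measurable: "euclidean_cond_exp M G f \<in> borel_measurable G"
  unfolding euclidean_cond_exp_def by measurable

lemma euclidean_cond_exp_inner:
  assumes "b \<in> Basis"
  shows "euclidean_cond_exp M G f x \<bullet> b = real_cond_exp M G (\<lambda>x. f x \<bullet> b) x"
  using assms by (simp add: euclidean_cond_exp_def)

lemma stopped_process_increment:
  fixes S :: "nat \<Rightarrow> 'a \<Rightarrow> 'b::real_vector"
  shows "indicator {\<omega>. \<tau> \<omega> > 0} \<omega> *\<^sub>R stopped_process S \<tau> (Suc t) \<omega>
       - indicator {\<omega>. \<tau> \<omega> > 0} \<omega> *\<^sub>R stopped_process S \<tau> t \<omega>
       = (if \<tau> \<omega> \<le> enat t then 0 else 1 :: real) *\<^sub>R (S (Suc t) \<omega> - S t \<omega>)"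
proof (cases "\<tau> \<omega> \<le> enat t")
  case True
  then have "\<tau> \<omega> \<le> enat (Suc t)" by (meson enat_ord_simps(1) le_SucI order.trans order_refl)
  with True show ?thesis by (simp add: stopped_process_def min_absorb2)
next
  case False
  then have "enat t < \<tau> \<omega>" by simp
  then have "enat (Suc t) \<le> \<tau> \<omega>" by (metis eSuc_enat ileI1)
  moreover have "0 < \<tau> \<omega>" using \<open>enat t < \<tau> \<omega>\<close> by (metis i0_lb order_le_less_trans)
  ultimately show ?thesis using \<open>enat t < \<tau> \<omega>\<close> by (auto simp: stopped_process_def min_absorb1)
qed

lemma (in finite_measure_subalgebra) mean_zero_given_cond_exp:
  assumes "mean_zero_given M F f"
  shows "AE x in M. real_cond_exp M F f x = 0"
proof (rule real_cond_exp_charact)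
  show "integrable M f" using assms by (simp add: mean_zero_given_def)
  fix A assume "A \<in> sets F"
  then have "(\<integral>x. indicator A x * f x \<partial>M) = 0"
    by (intro mean_zero_givenD[OF assms, of _ 1]) (auto simp: indicator_def)
  then show "(\<integral>x\<in>A. f x \<partial>M) = (\<integral>x\<in>A. 0 \<partial>M)" by (simp add: set_lebesgue_integral_def)
qed auto

context
  fixes M :: "'a measure" and F :: "nat \<Rightarrow> 'a measure" and S :: "nat \<Rightarrow> 'a \<Rightarrow> 'b::euclidean_space"
  assumes M: "prob_space M" and sub: "\<And>t. subalgebra M (F t)"
    and S: "local_martingale M F S"
begin

interpretation prob_space M by (rule M)

text \<open>Each stopped process is almost surely equal to a conditional expectation, hence to an adapted
  process, and \<open>S\<close> is the limit of the stopped processes.\<close>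

lemma local_martingale_adapted_version:
  "\<exists>S'. \<forall>t. S' t \<in> borel_measurable (F t) \<and> (AE x in M. S t x = S' t x)"
proof -
  obtain \<tau> :: "nat \<Rightarrow> 'a \<Rightarrow> enat" where \<tau>: "AE \<omega> in M. (\<lambda>n. \<tau> n \<omega>) \<longlonglongrightarrow> \<infinity>"
    and X: "\<And>n. martingale M F (\<lambda>t \<omega>. indicator {\<omega>. \<tau> n \<omega> > 0} \<omega> *\<^sub>R stopped_process S (\<tau> n) t \<omega>)"
    using S unfolding local_martingale_def by blast
  define X where "X = (\<lambda>n t \<omega>. indicator {\<omega>. \<tau> n \<omega> > 0} \<omega> *\<^sub>R stopped_process S (\<tau> n) t \<omega>)"
  define h where "h = (\<lambda>t n. euclidean_cond_exp M (F t) (X n (Suc t)))"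
  define S' where "S' = (\<lambda>t \<omega>. lim (\<lambda>n. h t n \<omega>))"
  have "S' t \<in> borel_measurable (F t)" for t
    unfolding S'_def by (rule borel_measurable_lim_metric) (simp add: h_def euclidean_cond_exp_measurable)
  moreover have "AE \<omega> in M. S t \<omega> = S' t \<omega>" for t
  proof -
    have "AE \<omega> in M. \<forall>n. h t n \<omega> = X n t \<omega>"
      using X unfolding AE_all_countable martingale_def h_def X_def by blast
    then show ?thesis using \<tau>
    proof eventually_elim
      case (elim \<omega>)
      have "\<forall>\<^sub>F n in sequentially. h t n \<omega> = S t \<omega>"
        using enat_tendsto_infinity_eventually[OF elim(2), of t]
      proof eventually_elim
        case (elim n)
        then have "0 < \<tau> n \<omega>" by (metis i0_lb order_le_less_trans)
        with elim have "X n t \<omega> = S t \<omega>" by (simp add: X_def stopped_process_def min_absorb1)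
        with \<open>\<forall>n. h t n \<omega> = X n t \<omega>\<close> show ?case by simp
      qed
      then have "(\<lambda>n. h t n \<omega>) \<longlonglongrightarrow> S t \<omega>" by (rule tendsto_eventually)
      then show ?case by (simp add: S'_def limI)
    qed
  qed
  ultimately show ?thesis by blast
qed

text \<open>Let \<open>q\<close> be the conditional expectation of \<open>\<bar>V\<bar>\<close>, where \<open>V\<close> is the increment. It is finite almost
  surely: on the event that \<open>\<tau> n\<close> exceeds \<open>t\<close>, which is known at time \<open>t\<close>, the increment is that of an
  integrable stopped process, and these events exhaust the space as \<open>n\<close> grows. Division by \<open>1 + q\<close>
  therefore makes \<open>V\<close> integrable; its conditional mean is zero because it is zero on each of these
  events.\<close>

lemma local_martingale_normalized_increment:
  assumes S': "\<And>t. S' t \<in> borel_measurable (F t)" "\<And>t. AE x in M. S t x = S' t x"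
  shows "\<exists>\<phi>\<in>borel_measurable (F t). (\<forall>x. 0 < \<phi> x) \<and>
     (\<forall>b\<in>Basis. mean_zero_given M (F t) (\<lambda>x. \<phi> x * ((S' (Suc t) x - S' t x) \<bullet> b)))"
proof -
  interpret G: finite_measure_subalgebra M "F t" by standard (rule sub)
  obtain \<tau> :: "nat \<Rightarrow> 'a \<Rightarrow> enat" where st: "\<And>n. ext_stopping_time F (\<tau> n)"
    and \<tau>: "AE \<omega> in M. (\<lambda>n. \<tau> n \<omega>) \<longlonglongrightarrow> \<infinity>"
    and Xm: "\<And>n. martingale M F (\<lambda>t \<omega>. indicator {\<omega>. \<tau> n \<omega> > 0} \<omega> *\<^sub>R stopped_process S (\<tau> n) t \<omega>)"
    using S unfolding local_martingale_def by blast
  define X where "X = (\<lambda>n t \<omega>. indicator {\<omega>. \<tau> n \<omega> > 0} \<omega> *\<^sub>R stopped_process S (\<tau> n) t \<omega>)"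
  have Xi: "integrable M (X n s)" for n s using Xm[of n] by (auto simp: martingale_def X_def)
  have XM[measurable]: "X n s \<in> borel_measurable M" for n s using Xi by auto
  have Xe: "AE x in M. euclidean_cond_exp M (F t) (X n (Suc t)) x = X n t x" for n
    using Xm[of n] by (auto simp: martingale_def X_def)
  define V where "V = (\<lambda>x. S' (Suc t) x - S' t x)"
  have S'M[measurable]: "S' s \<in> borel_measurable M" for s
    using measurable_from_subalg[OF sub S'(1)] .
  have VM[measurable]: "V \<in> borel_measurable M" unfolding V_def by measurable
  define \<beta> where "\<beta> = (\<lambda>n \<omega>. if \<tau> n \<omega> \<le> enat t then 0 else 1 :: real)"
  have \<beta>F[measurable]: "\<beta> n \<in> borel_measurable (F t)" for n
  proof -
    have [measurable]: "Measurable.pred (F t) (\<lambda>\<omega>. \<tau> n \<omega> \<le> enat t)"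
      using st[of n] by (simp add: ext_stopping_time_def)
    show ?thesis unfolding \<beta>_def by measurable
  qed
  have \<beta>M[measurable]: "\<beta> n \<in> borel_measurable M" for n using G.measurable_sub[OF \<beta>F] .
  have \<beta>01: "0 \<le> \<beta> n x" "\<bar>\<beta> n x\<bar> \<le> 1" for n x by (auto simp: \<beta>_def)
  have \<beta>lim: "AE x in M. \<forall>\<^sub>F n in sequentially. \<beta> n x = 1"
    using \<tau>
  proof eventually_elim
    case (elim x)
    show ?case using enat_tendsto_infinity_eventually[OF elim, of t] by eventually_elim (simp add: \<beta>_def)
  qed
  have diff: "AE x in M. X n (Suc t) x - X n t x = \<beta> n x *\<^sub>R V x" for n
    using S'(2)[of t] S'(2)[of "Suc t"]
    by eventually_elim (simp only: X_def V_def \<beta>_def stopped_process_increment)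
  have \<beta>Vi: "integrable M (\<lambda>x. \<beta> n x *\<^sub>R V x)" for n
  proof -
    have "integrable M (\<lambda>x. X n (Suc t) x - X n t x)" using Xi by auto
    then show ?thesis using diff[of n] by (subst integrable_cong_AE[symmetric]) auto
  qed
  have \<beta>V0: "AE x in M. real_cond_exp M (F t) (\<lambda>x. \<beta> n x * (V x \<bullet> b)) x = 0" if b: "b \<in> Basis" for n b
  proof -
    let ?E = "real_cond_exp M (F t)"
    have i: "integrable M (\<lambda>x. X n s x \<bullet> b)" for s using Xi by auto
    have "AE x in M. ?E (\<lambda>x. \<beta> n x * (V x \<bullet> b)) x = ?E (\<lambda>x. X n (Suc t) x \<bullet> b - X n t x \<bullet> b) x"
    proof (rule G.real_cond_exp_cong)
      show "AE x in M. \<beta> n x * (V x \<bullet> b) = X n (Suc t) x \<bullet> b - X n t x \<bullet> b"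
        using diff[of n] by eventually_elim (simp flip: inner_diff_left)
    qed measurable
    moreover have "AE x in M. ?E (\<lambda>x. X n (Suc t) x \<bullet> b - X n t x \<bullet> b) x
        = ?E (\<lambda>x. X n (Suc t) x \<bullet> b) x - ?E (\<lambda>x. X n t x \<bullet> b) x"
      using i by (intro G.real_cond_exp_diff)
    moreover have *: "AE x in M. ?E (\<lambda>x. X n (Suc t) x \<bullet> b) x = X n t x \<bullet> b"
      using Xe[of n] by eventually_elim (metis b euclidean_cond_exp_inner)
    moreover have "AE x in M. ?E (\<lambda>x. X n t x \<bullet> b) x = X n t x \<bullet> b"
    proof -
      have "AE x in M. ?E (\<lambda>x. X n t x \<bullet> b) x = ?E (?E (\<lambda>x. X n (Suc t) x \<bullet> b)) x"
        using * i by (intro G.real_cond_exp_cong) auto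
      moreover have "AE x in M. ?E (?E (\<lambda>x. X n (Suc t) x \<bullet> b)) x = ?E (\<lambda>x. X n (Suc t) x \<bullet> b) x"
        using i by (intro G.real_cond_exp_F_meas G.real_cond_exp_int) auto
      ultimately show ?thesis using * by eventually_elim simp
    qed
    ultimately show ?thesis by eventually_elim simp
  qed
  define q where "q = nn_cond_exp M (F t) (\<lambda>x. ennreal (norm (V x)))"
  have qF[measurable]: "q \<in> borel_measurable (F t)" unfolding q_def by measurable
  have qM[measurable]: "q \<in> borel_measurable M" using measurable_from_subalg[OF sub qF] .
  have q_fin: "AE x in M. q x \<noteq> \<infinity>"
  proof -
    have "AE x in M. ennreal (\<beta> n x) * q x \<noteq> \<infinity>" for n
    proof (rule nn_integral_PInf_AE)
      have "(\<integral>\<^sup>+x. ennreal (\<beta> n x) * q x \<partial>M) = (\<integral>\<^sup>+x. ennreal (\<beta> n x) * ennreal (norm (V x)) \<partial>M)"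
        unfolding q_def by (rule G.nn_cond_exp_intg) auto
      also have "\<dots> = (\<integral>\<^sup>+x. ennreal (norm (\<beta> n x *\<^sub>R V x)) \<partial>M)"
        using \<beta>01 by (simp add: ennreal_mult)
      also have "\<dots> < \<infinity>" using \<beta>Vi[of n] by (simp add: integrable_iff_bounded)
      finally show "(\<integral>\<^sup>+x. ennreal (\<beta> n x) * q x \<partial>M) \<noteq> \<infinity>" by simp
    qed measurable
    then have "AE x in M. \<forall>n. ennreal (\<beta> n x) * q x \<noteq> \<infinity>" by (simp add: AE_all_countable)
    then show ?thesis using \<beta>lim
    proof eventually_elim
      case (elim x)
      then obtain n where "\<beta> n x = 1" by (auto simp: eventually_sequentially)
      with elim(1)[rule_format, of n] show ?case by simp
    qed
  qed
  \<comment> \<open>On the null set where \<open>q\<close> is infinite, \<open>enn2real\<close> gives \<open>0\<close> and \<open>\<phi>\<close> is still positive.\<close>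
  define \<phi> where "\<phi> = (\<lambda>x. 1 / (1 + enn2real (q x)))"
  have \<phi>F[measurable]: "\<phi> \<in> borel_measurable (F t)" unfolding \<phi>_def by measurable
  have \<phi>M[measurable]: "\<phi> \<in> borel_measurable M" using G.measurable_sub[OF \<phi>F] .
  have \<phi>1: "0 < \<phi> x" "\<bar>\<phi> x\<bar> \<le> 1" for x
  proof -
    have "0 < 1 + enn2real (q x)" using enn2real_nonneg[of "q x"] by linarith
    then show "0 < \<phi> x" "\<bar>\<phi> x\<bar> \<le> 1" by (simp_all add: \<phi>_def)
  qed
  have \<phi>Vi: "integrable M (\<lambda>x. \<phi> x * norm (V x))"
  proof (rule integrableI_bounded)
    have "(\<integral>\<^sup>+x. ennreal (norm (\<phi> x * norm (V x))) \<partial>M) = (\<integral>\<^sup>+x. ennreal (\<phi> x) * ennreal (norm (V x)) \<partial>M)"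
      using \<phi>1 by (simp add: ennreal_mult abs_mult less_imp_le)
    also have "\<dots> = (\<integral>\<^sup>+x. ennreal (\<phi> x) * q x \<partial>M)"
      unfolding q_def by (rule G.nn_cond_exp_intg[symmetric]) auto
    also have "\<dots> \<le> (\<integral>\<^sup>+x. 1 \<partial>M)"
    proof (rule nn_integral_mono_AE)
      show "AE x in M. ennreal (\<phi> x) * q x \<le> 1"
        using q_fin
      proof eventually_elim
        case (elim x)
        then have "ennreal (\<phi> x) * q x = ennreal (\<phi> x * enn2real (q x))"
          using \<phi>1(1)[of x] by (simp add: ennreal_mult less_top)
        also have "\<phi> x * enn2real (q x) \<le> 1"
          using enn2real_nonneg[of "q x"] by (simp add: \<phi>_def divide_le_eq_1 add_pos_nonneg)
        finally show ?case by (simp add: ennreal_leI)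
      qed
    qed
    also have "\<dots> < \<infinity>" by (simp add: emeasure_space_1)
    finally show "(\<integral>\<^sup>+x. ennreal (norm (\<phi> x * norm (V x))) \<partial>M) < \<infinity>" .
  qed measurable
  have "mean_zero_given M (F t) (\<lambda>x. \<phi> x * (V x \<bullet> b))" if b: "b \<in> Basis" for b
    unfolding mean_zero_given_def
  proof (intro conjI allI impI)
    have Vb: "\<bar>V x \<bullet> b\<bar> \<le> norm (V x)" for x using b by (rule Basis_le_norm)
    show "integrable M (\<lambda>x. \<phi> x * (V x \<bullet> b))"
      by (rule Bochner_Integration.integrable_bound[OF \<phi>Vi])
         (use Vb in \<open>auto simp: abs_mult intro!: mult_left_mono\<close>)
    fix g :: "'a \<Rightarrow> real" and C :: real assume g: "g \<in> borel_measurable (F t)" "\<forall>x. \<bar>g x\<bar> \<le> C"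
    have gM[measurable]: "g \<in> borel_measurable M" using G.measurable_sub g(1) .
    have C0: "0 \<le> C" using order_trans[OF abs_ge_zero g(2)[rule_format]] .
    have bd: "\<bar>g x * (\<phi> x * (V x \<bullet> b))\<bar> \<le> C * (\<phi> x * norm (V x))" for x
      using g(2)[rule_format, of x] Vb[of x] \<phi>1(1)[of x] C0 unfolding abs_mult
      by (intro mult_mono) auto
    show "(\<integral>x. g x * (\<phi> x * (V x \<bullet> b)) \<partial>M) = 0"
    proof (rule LIMSEQ_unique)
      show "(\<lambda>n. \<integral>x. \<beta> n x * (g x * (\<phi> x * (V x \<bullet> b))) \<partial>M) \<longlonglongrightarrow> (\<integral>x. g x * (\<phi> x * (V x \<bullet> b)) \<partial>M)"
      proof (rule integral_dominated_convergence[where w="\<lambda>x. C * (\<phi> x * norm (V x))"])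
        show "integrable M (\<lambda>x. C * (\<phi> x * norm (V x)))" using \<phi>Vi by simp
        show "AE x in M. (\<lambda>n. \<beta> n x * (g x * (\<phi> x * (V x \<bullet> b)))) \<longlonglongrightarrow> g x * (\<phi> x * (V x \<bullet> b))"
          using \<beta>lim
        proof eventually_elim
          case (elim x)
          show ?case by (rule tendsto_eventually, rule eventually_mono[OF elim]) simp
        qed
        have "\<bar>\<beta> n x * (g x * (\<phi> x * (V x \<bullet> b)))\<bar> \<le> C * (\<phi> x * norm (V x))" for n x
          using bd[of x] order_trans[OF abs_ge_zero bd[of x]] by (auto simp: \<beta>_def)
        then show "AE x in M. norm (\<beta> n x * (g x * (\<phi> x * (V x \<bullet> b)))) \<le> C * (\<phi> x * norm (V x))" for n
          by simp
      qed measurable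
      have "(\<integral>x. \<beta> n x * (g x * (\<phi> x * (V x \<bullet> b))) \<partial>M) = 0" for n
      proof -
        have i: "integrable M (\<lambda>x. \<beta> n x * (V x \<bullet> b))"
          using integrable_inner_left[OF \<beta>Vi[of n], of b] by simp
        have "\<bar>g x * \<phi> x\<bar> \<le> C * 1" for x
          using g(2)[rule_format, of x] \<phi>1(2)[of x] C0 unfolding abs_mult by (intro mult_mono) auto
        then have "integrable M (\<lambda>x. (g x * \<phi> x) * (\<beta> n x * (V x \<bullet> b)))"
          by (intro integrable_bounded_mult[OF _ _ i]) measurable
        then have "(\<integral>x. (g x * \<phi> x) * (\<beta> n x * (V x \<bullet> b)) \<partial>M) = 0"
          using \<beta>V0[OF b] i g(1) by (intro G.integral_mult_cond_exp_zero) auto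
        then show ?thesis by (simp add: mult_ac)
      qed
      then show "(\<lambda>n. \<integral>x. \<beta> n x * (g x * (\<phi> x * (V x \<bullet> b))) \<partial>M) \<longlonglongrightarrow> 0" by simp
    qed
  qed
  then show ?thesis using \<phi>F \<phi>1(1) unfolding V_def by blast
qed

end

section \<open>The equivalent martingale density\<close>

lemma uniformly_integrable_bounded:
  fixes Z :: "nat \<Rightarrow> 'a \<Rightarrow> real"
  assumes i: "\<And>t. integrable M (Z t)" and b: "\<And>t. AE x in M. \<bar>Z t x\<bar> \<le> C"
  shows "uniformly_integrable M Z"
proof -
  have "(\<integral>\<^sup>+ \<omega>. ennreal (norm (Z t \<omega>)) * indicator {\<omega>. K < norm (Z t \<omega>)} \<omega> \<partial>M) = 0" if "C \<le> K" for t K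
  proof -
    have "(\<integral>\<^sup>+ \<omega>. ennreal (norm (Z t \<omega>)) * indicator {\<omega>. K < norm (Z t \<omega>)} \<omega> \<partial>M) = (\<integral>\<^sup>+ \<omega>. 0 \<partial>M)"
      using b[of t] by (intro nn_integral_cong_AE, eventually_elim) (use that in auto)
    then show ?thesis by simp
  qed
  then have "eventually (\<lambda>K. (SUP t. \<integral>\<^sup>+ \<omega>. ennreal (norm (Z t \<omega>)) * indicator {\<omega>. K < norm (Z t \<omega>)} \<omega> \<partial>M) = 0) at_top"
    unfolding eventually_at_top_linorder by (intro exI[of _ C]) simp
  then show ?thesis
    unfolding uniformly_integrable_def using i by (auto intro: tendsto_eventually)
qed

theorem theorem1p1:
  fixes M :: "'a measure"
    and F :: "nat \<Rightarrow> 'a measure"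
    and S :: "nat \<Rightarrow> 'a \<Rightarrow> real ^ 'd"
    and \<epsilon> :: real
  assumes "prob_space M"
    and "filtration (space M) F"
    and "\<And>t. subalgebra M (F t)"
    and "local_martingale M F S"
    and "\<epsilon> > 0"
  shows "\<exists>Z :: nat \<Rightarrow> 'a \<Rightarrow> real.
           martingale M F Z \<and>
           uniformly_integrable M Z \<and>
           (\<forall>t. AE \<omega> in M. Z t \<omega> \<le> 1 + \<epsilon>) \<and>
           (AE \<omega> in M. convergent (\<lambda>t. Z t \<omega>) \<and> lim (\<lambda>t. Z t \<omega>) > 0) \<and>
           (\<integral>\<omega>. lim (\<lambda>t. Z t \<omega>) \<partial>M) = 1 \<and>
           martingale M F (\<lambda>t \<omega>. Z t \<omega> *\<^sub>R S t \<omega>) \<and>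
           (\<forall>t. \<forall>p::nat. p \<ge> 1 \<longrightarrow> integrable M (\<lambda>\<omega>. Z t \<omega> * norm (S t \<omega>) ^ p))"
proof -
  interpret prob_space M by (rule assms(1))
  obtain S' where S': "\<And>t. S' t \<in> borel_measurable (F t)" "\<And>t. AE x in M. S t x = S' t x"
    using local_martingale_adapted_version[OF assms(1,3,4)] by blast
  define V where "V = (\<lambda>t x. S' (Suc t) x - S' t x)"
  have "\<forall>t. \<exists>\<phi>. \<phi> \<in> borel_measurable (F t) \<and> (\<forall>x. 0 < \<phi> x) \<and>
     (\<forall>b\<in>Basis. mean_zero_given M (F t) (\<lambda>x. \<phi> x * (V t x \<bullet> b)))"
    using local_martingale_normalized_increment[OF assms(1,3,4) S'] unfolding V_def by blast
  then obtain \<phi> where \<phi>: "\<And>t. \<phi> t \<in> borel_measurable (F t)" "\<And>t x. 0 < \<phi> t x"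
    and \<phi>V: "\<And>t b. b \<in> Basis \<Longrightarrow> mean_zero_given M (F t) (\<lambda>x. \<phi> t x * (V t x \<bullet> b))"
    by (auto simp: choice_iff)
  define \<Y> where "\<Y> = (\<lambda>t. (\<lambda>b x. \<phi> t x * (V t x \<bullet> b)) ` Basis)"
  have sub_mono: "subalgebra (F t) (F s)" if "s \<le> t" for s t
    using assms(2) that by (auto simp: subalgebra_def filtration_def)
  have up: "f \<in> borel_measurable (F (Suc t))" if "f \<in> borel_measurable (F t)"
    for f :: "'a \<Rightarrow> 'c::topological_space" and t
    by (rule measurable_from_subalg[OF sub_mono that]) simp
  interpret Y: martingale_differences M F \<Y>
  proof (intro martingale_differences.intro martingale_differences_axioms.intro assms(1-3))
    show "f \<in> borel_measurable (F (Suc t))" if "f \<in> \<Y> t" for t f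
      using that up[OF \<phi>(1)[of t]] S'(1)[of "Suc t"] up[OF S'(1)[of t]] by (auto simp: \<Y>_def V_def)
    show "mean_zero_given M (F t) f" if "f \<in> \<Y> t" for t f using that \<phi>V by (auto simp: \<Y>_def)
  qed (simp add: \<Y>_def)
  obtain D :: "'a \<Rightarrow> real"
  where DM[measurable]: "D \<in> borel_measurable M" and D0: "\<And>x. 0 \<le> D x" and D1: "\<And>x. D x \<le> 1 + \<epsilon>"
    and Dpos: "AE x in M. 0 < D x" and Dint: "(\<integral>x. D x \<partial>M) = 1"
    and Zlim: "AE x in M. (\<lambda>t. real_cond_exp M (F t) D x) \<longlonglongrightarrow> D x"
    and DY: "\<And>t f. f \<in> \<Y> t \<Longrightarrow> mean_zero_given M (F t) (\<lambda>x. D x * f x)"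
    and DX: "\<And>n p. integrable M (\<lambda>x. D x * norm (S' n x) ^ p)"
  proof (rule Y.equivalent_density[of "\<lambda>n x. norm (S' n x)" \<epsilon>])
    show "(\<lambda>x. norm (S' n x)) \<in> borel_measurable (F n)" for n using S'(1) by measurable
  qed (use assms(5) in auto)
  have iD: "integrable M D" using D0 D1 by (intro integrable_const_bound[where B="1 + \<epsilon>"]) auto
  define Z where "Z = (\<lambda>t. real_cond_exp M (F t) D)"
  have G: "finite_measure_subalgebra M (F t)" for t by standard (rule assms(3))
  have S'M[measurable]: "S' t \<in> borel_measurable M" for t
    using measurable_from_subalg[OF assms(3) S'(1)] .
  have SM[measurable]: "S t \<in> borel_measurable M" for t using assms(4) by (simp add: local_martingale_def)
  have ZM[measurable]: "Z t \<in> borel_measurable M" for t unfolding Z_def by measurable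
  have iZ: "integrable M (Z t)" for t
  proof -
    interpret G: finite_measure_subalgebra M "F t" by (rule G)
    show ?thesis unfolding Z_def using iD by (rule G.real_cond_exp_int)
  qed
  have Z01: "AE x in M. 0 \<le> Z t x \<and> Z t x \<le> 1 + \<epsilon>" for t
  proof -
    interpret G: finite_measure_subalgebra M "F t" by (rule G)
    have "AE x in M. 0 \<le> Z t x" unfolding Z_def using D0 by (intro G.real_cond_exp_pos) auto
    moreover have "AE x in M. Z t x \<le> 1 + \<epsilon>" unfolding Z_def using iD D1 by (intro G.real_cond_exp_le_c) auto
    ultimately show ?thesis by eventually_elim auto
  qed
  have nested: "AE x in M. real_cond_exp M (F t) (real_cond_exp M (F (Suc t)) f) x = real_cond_exp M (F t) f x"
    if "integrable M f" for t f
  proof -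
    interpret G: finite_measure_subalgebra M "F t" by (rule G)
    show ?thesis using that assms(3) sub_mono by (intro G.real_cond_exp_nested_subalg) auto
  qed
  have "martingale M F Z"
    unfolding martingale_def euclidean_cond_exp_real using iZ nested[OF iD] by (simp add: Z_def)
  moreover have "uniformly_integrable M Z"
  proof (rule uniformly_integrable_bounded[OF iZ])
    show "AE x in M. \<bar>Z t x\<bar> \<le> 1 + \<epsilon>" for t using Z01[of t] by eventually_elim auto
  qed
  moreover have "AE \<omega> in M. Z t \<omega> \<le> 1 + \<epsilon>" for t using Z01[of t] by eventually_elim auto
  moreover have "AE \<omega> in M. convergent (\<lambda>t. Z t \<omega>) \<and> lim (\<lambda>t. Z t \<omega>) > 0"
    using Zlim Dpos unfolding Z_def by eventually_elim (auto simp: limI convergentI)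
  moreover have "(\<integral>\<omega>. lim (\<lambda>t. Z t \<omega>) \<partial>M) = 1"
  proof -
    have "(\<integral>\<omega>. lim (\<lambda>t. Z t \<omega>) \<partial>M) = (\<integral>\<omega>. D \<omega> \<partial>M)"
    proof (rule integral_cong_AE)
      show "AE x in M. lim (\<lambda>t. Z t x) = D x"
        using Zlim unfolding Z_def by eventually_elim (rule limI)
    qed (auto intro: borel_measurable_lim_metric)
    with Dint show ?thesis by simp
  qed
  moreover have ZSp: "integrable M (\<lambda>\<omega>. Z t \<omega> * norm (S t \<omega>) ^ p)" for t p
  proof -
    interpret G: finite_measure_subalgebra M "F t" by (rule G)
    have i: "integrable M (\<lambda>x. norm (S' t x) ^ p * D x)" using DX[of t p] by (simp add: mult.commute)
    have "AE x in M. real_cond_exp M (F t) (\<lambda>x. norm (S' t x) ^ p * D x) x = norm (S' t x) ^ p * Z t x"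
      unfolding Z_def
    proof (rule G.real_cond_exp_mult[OF _ DM i])
      show "(\<lambda>x. norm (S' t x) ^ p) \<in> borel_measurable (F t)" using S'(1)[of t] by measurable
    qed
    then have "AE x in M. real_cond_exp M (F t) (\<lambda>x. norm (S' t x) ^ p * D x) x = Z t x * norm (S t x) ^ p"
      using S'(2)[of t] by eventually_elim (simp add: mult.commute)
    then show ?thesis
      using G.real_cond_exp_int(1)[OF i] by (subst integrable_cong_AE[symmetric]) auto
  qed
  moreover have "martingale M F (\<lambda>t \<omega>. Z t \<omega> *\<^sub>R S t \<omega>)"
    unfolding martingale_def
  proof (intro conjI allI)
    fix t
    interpret G: finite_measure_subalgebra M "F t" by (rule G)
    interpret G': finite_measure_subalgebra M "F (Suc t)" by (rule G)
    let ?E = "real_cond_exp M (F t)"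
    show "integrable M (\<lambda>\<omega>. Z t \<omega> *\<^sub>R S t \<omega>)" for t
    proof (rule integrable_norm_cancel)
      show "integrable M (\<lambda>x. norm (Z t x *\<^sub>R S t x))"
        using integrable_abs[OF ZSp[of t 1]] by (simp add: abs_mult)
    qed measurable
    have "AE x in M. ?E (\<lambda>x. (Z (Suc t) x *\<^sub>R S (Suc t) x) \<bullet> b) x = Z t x * (S t x \<bullet> b)"
      if b: "b \<in> Basis" for b
    proof -
      have iDS: "integrable M (\<lambda>x. (S' s x \<bullet> b) * D x)" for s
      proof (rule Bochner_Integration.integrable_bound[OF DX[of s 1]])
        have "\<bar>S' s x \<bullet> b\<bar> \<le> norm (S' s x)" for x using b by (rule Basis_le_norm)
        then show "AE x in M. norm (S' s x \<bullet> b * D x) \<le> norm (D x * norm (S' s x) ^ 1)"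
          using D0 by (auto simp: abs_mult mult.commute intro!: mult_left_mono)
      qed measurable
      have iDV: "integrable M (\<lambda>x. D x * (V t x \<bullet> b))"
        using Bochner_Integration.integrable_diff[OF iDS[of "Suc t"] iDS[of t]]
        by (simp add: V_def algebra_simps)
      have "mean_zero_given M (F t) (\<lambda>x. D x * (\<phi> t x * (V t x \<bullet> b)))"
        using DY[of _ t] b by (simp add: \<Y>_def)
      then have mz: "mean_zero_given M (F t) (\<lambda>x. \<phi> t x * (D x * (V t x \<bullet> b)))"
        by (simp add: mult.left_commute)
      have split: "(\<lambda>x. (S' (Suc t) x \<bullet> b) * D x) = (\<lambda>x. (S' t x \<bullet> b) * D x + D x * (V t x \<bullet> b))"
        by (auto simp: V_def algebra_simps)
      \<comment> \<open>The positive normalization, known at time \<open>t\<close>, comes out of the conditional expectation.\<close>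
      have "AE x in M. ?E (\<lambda>x. D x * (V t x \<bullet> b)) x = 0"
      proof -
        have "AE x in M. ?E (\<lambda>x. \<phi> t x * (D x * (V t x \<bullet> b))) x = \<phi> t x * ?E (\<lambda>x. D x * (V t x \<bullet> b)) x"
          using \<phi>(1)[of t] iDV mz by (intro G.real_cond_exp_mult) (auto simp: mean_zero_given_def)
        with G.mean_zero_given_cond_exp[OF mz] show ?thesis
          by eventually_elim (use \<phi>(2)[of t] in \<open>simp add: order_less_imp_not_eq2\<close>)
      qed
      moreover have "AE x in M. ?E (\<lambda>x. (S' (Suc t) x \<bullet> b) * D x) x
          = ?E (\<lambda>x. (S' t x \<bullet> b) * D x) x + ?E (\<lambda>x. D x * (V t x \<bullet> b)) x"
        unfolding split using iDS iDV by (intro G.real_cond_exp_add)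
      moreover have "AE x in M. ?E (\<lambda>x. (S' t x \<bullet> b) * D x) x = (S' t x \<bullet> b) * Z t x"
        unfolding Z_def using S'(1)[of t] iDS by (intro G.real_cond_exp_mult) auto
      moreover have "AE x in M. ?E (real_cond_exp M (F (Suc t)) (\<lambda>x. (S' (Suc t) x \<bullet> b) * D x)) x
          = ?E (\<lambda>x. (S' (Suc t) x \<bullet> b) * D x) x"
        by (rule nested[OF iDS])
      moreover have "AE x in M. ?E (\<lambda>x. (Z (Suc t) x *\<^sub>R S (Suc t) x) \<bullet> b) x
          = ?E (real_cond_exp M (F (Suc t)) (\<lambda>x. (S' (Suc t) x \<bullet> b) * D x)) x"
      proof (rule G.real_cond_exp_cong)
        have "AE x in M. real_cond_exp M (F (Suc t)) (\<lambda>x. (S' (Suc t) x \<bullet> b) * D x) x = (S' (Suc t) x \<bullet> b) * Z (Suc t) x"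
          unfolding Z_def using S'(1)[of "Suc t"] iDS by (intro G'.real_cond_exp_mult) auto
        then show "AE x in M. (Z (Suc t) x *\<^sub>R S (Suc t) x) \<bullet> b
            = real_cond_exp M (F (Suc t)) (\<lambda>x. (S' (Suc t) x \<bullet> b) * D x) x"
          using S'(2)[of "Suc t"] by eventually_elim simp
      qed measurable
      ultimately show ?thesis using S'(2)[of t] by eventually_elim simp
    qed
    then have "AE x in M. \<forall>b\<in>Basis. ?E (\<lambda>x. (Z (Suc t) x *\<^sub>R S (Suc t) x) \<bullet> b) x = Z t x * (S t x \<bullet> b)"
      by (intro AE_finite_allI) auto
    then show "AE x in M. euclidean_cond_exp M (F t) (\<lambda>x. Z (Suc t) x *\<^sub>R S (Suc t) x) x = Z t x *\<^sub>R S t x"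
    proof eventually_elim
      case (elim x)
      then have "euclidean_cond_exp M (F t) (\<lambda>x. Z (Suc t) x *\<^sub>R S (Suc t) x) x
          = (\<Sum>b\<in>Basis. (Z t x *\<^sub>R S t x \<bullet> b) *\<^sub>R b)"
        unfolding euclidean_cond_exp_def by (intro sum.cong) auto
      then show ?case by (simp only: euclidean_representation)
    qed
  qed
  ultimately show ?thesis by (intro exI[of _ Z]) auto
qed

end
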